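(* Let $\left\{\mathcal{N}^{(i)}_{A \to B }\right\}_{i=1}^s$ be a compound quantum channel and let $\varepsilon,\eta \in (0,1)$. Let $A'\equiv A$ be a purifying register. Then, for any $R$ satisfying \begin{equation*} R \leq\max _{|\psi\rangle\langle\psi|_{A A'}} \left( \min_{i \in [1:s]} \mathrm{I}^{\varepsilon}_{\mathrm{H}}(B:A')_{\mathcal{N}^{(i)}_{A \to B } (|\psi\rangle\langle\psi|_{AA'})} + (2\log2s)\log \left(\frac{\eta}{6\log(2s)}\right) + \log\frac{\varepsilon}{4s}\right), \end{equation*} there exists an $(R,\varepsilon+3\eta)$-entanglement assisted code for the compound quantum channel $\left\{\mathcal{N}^{(i)}_{A \to B }\right\}_{i=1}^s.$
   Context: For quantum states $\rho,\sigma$, the smooth hypothesis testing divergence is $\mathrm{D}^{\varepsilon}_{\mathrm{H}}(\rho\|\sigma) := \max_{0\preceq M\preceq \mathbb{I},\ \mathrm{Tr}[M\rho]\geq 1-\varepsilon} -\log\mathrm{Tr}[M\sigma]$. For a bipartite state $\rho_{BA'}$, $\mathrm{I}^{\varepsilon}_{\mathrm{H}}(B:A')_{\rho} := \min_{\sigma_B} \mathrm{D}^{\varepsilon}_{\mathrm{H}}(\rho_{BA'}\|\sigma_B\otimes\rho_{A'})$, minimizing over all quantum states $\sigma_B$. A compound quantum channel is a finite collection of quantum channels $\{\mathcal{N}^{(i)}_{A\to B}\}_{i=1}^s$, one of which acts but neither party knows which. An $(R,\varepsilon)$-entanglement assisted code for it consists of a shared entangled pure state $|\theta\rangle_{E_AE_B}$,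 an encoding operation $\mathcal{E}: ME_A\to A$ for Alice (message register $M$, messages in $[1:2^R]$) and a decoding operation $\mathcal{D}: BE_B\to M'$ for Bob ($M'\equiv M$), such that for all messages $m$ and all $i\in[1:s]$, $\Pr\{M'\neq m\mid M=m\}\leq\varepsilon$. Logarithms are base 2. *)

theory Defs
  imports Complex_Main "Jordan_Normal_Form.Matrix" "HOL-Library.Extended_Real"
begin

text \<open>Finite-dimensional quantum information on explicit dimensions.
  Operators on a d-dimensional system are complex d x d matrices.
  Tensor-product convention: on a bipartite system X Y with dims dX, dY
  the basis index of (x,y) is x * dY + y (first factor is most significant).\<close>

definition tr :: "complex mat \<Rightarrow> complex" where
  "tr A = (\<Sum>i<dim_row A. A $$ (i,i))"

definition psd :: "nat \<Rightarrow> complex mat \<Rightarrow> bool" where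
  "psd n A \<longleftrightarrow> A \<in> carrier_mat n n \<and>
     (\<forall>v \<in> carrier_vec n.
        let q = (\<Sum>i<n. \<Sum>j<n. cnj (v $ i) * A $$ (i,j) * v $ j) in q \<in> \<real> \<and> 0 \<le> Re q)"

definition density :: "nat \<Rightarrow> complex mat \<Rightarrow> bool" where
  "density n \<rho> \<longleftrightarrow> psd n \<rho> \<and> tr \<rho> = 1"

definition unit_vector :: "nat \<Rightarrow> complex vec \<Rightarrow> bool" where
  "unit_vector n v \<longleftrightarrow> v \<in> carrier_vec n \<and> (\<Sum>i<n. (cmod (v $ i))\<^sup>2) = 1"

definition proj :: "complex vec \<Rightarrow> complex mat" where
  "proj v = mat (dim_vec v) (dim_vec v) (\<lambda>(i,j). v $ i * cnj (v $ j))"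

definition ket_bra :: "nat \<Rightarrow> nat \<Rightarrow> complex mat" where
  "ket_bra n m = mat n n (\<lambda>(i,j). if i = m \<and> j = m then 1 else 0)"

definition kron :: "complex mat \<Rightarrow> complex mat \<Rightarrow> complex mat" where
  "kron A B = mat (dim_row A * dim_row B) (dim_col A * dim_col B)
     (\<lambda>(i,j). A $$ (i div dim_row B, j div dim_col B) * B $$ (i mod dim_row B, j mod dim_col B))"

definition ptrace1 :: "nat \<Rightarrow> nat \<Rightarrow> complex mat \<Rightarrow> complex mat" where
  "ptrace1 d1 d2 X = mat d2 d2 (\<lambda>(i,j). \<Sum>k<d1. X $$ (k * d2 + i, k * d2 + j))"

definition block :: "nat \<Rightarrow> nat \<Rightarrow> nat \<Rightarrow> nat \<Rightarrow> complex mat \<Rightarrow> complex mat" where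
  "block dA k j l X = mat dA dA (\<lambda>(a,a'). X $$ (a * k + j, a' * k + l))"

definition tensor_id :: "nat \<Rightarrow> nat \<Rightarrow> nat \<Rightarrow> (complex mat \<Rightarrow> complex mat) \<Rightarrow> complex mat \<Rightarrow> complex mat" where
  "tensor_id dA dB k \<Phi> X = mat (dB * k) (dB * k)
     (\<lambda>(r,c). \<Phi> (block dA k (r mod k) (c mod k) X) $$ (r div k, c div k))"

definition is_channel :: "nat \<Rightarrow> nat \<Rightarrow> (complex mat \<Rightarrow> complex mat) \<Rightarrow> bool" where
  "is_channel dA dB \<Phi> \<longleftrightarrow>
     (\<forall>X \<in> carrier_mat dA dA. \<Phi> X \<in> carrier_mat dB dB) \<and>
     (\<forall>X \<in> carrier_mat dA dA. \<forall>Y \<in> carrier_mat dA dA. \<forall>c::complex.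
         \<Phi> (c \<cdot>\<^sub>m X + Y) = c \<cdot>\<^sub>m \<Phi> X + \<Phi> Y) \<and>
     (\<forall>X \<in> carrier_mat dA dA. tr (\<Phi> X) = tr X) \<and>
     (\<forall>k X. psd (dA * k) X \<longrightarrow> psd (dB * k) (tensor_id dA dB k \<Phi> X))"

definition neglog2 :: "real \<Rightarrow> ereal" where
  "neglog2 x = (if x \<le> 0 then \<infinity> else ereal (- log 2 x))"

definition D_H :: "real \<Rightarrow> nat \<Rightarrow> complex mat \<Rightarrow> complex mat \<Rightarrow> ereal" where
  "D_H eps n \<rho> \<sigma> =
     (SUP M \<in> {M. psd n M \<and> psd n (1\<^sub>m n - M) \<and> Re (tr (M * \<rho>)) \<ge> 1 - eps}.
        neglog2 (Re (tr (M * \<sigma>))))"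

definition I_H :: "real \<Rightarrow> nat \<Rightarrow> nat \<Rightarrow> complex mat \<Rightarrow> ereal" where
  "I_H eps dB dA' \<rho> =
     (INF \<sigma> \<in> {\<sigma>. density dB \<sigma>}. D_H eps (dB * dA') \<rho> (kron \<sigma> (ptrace1 dB dA' \<rho>)))"

text \<open>Number of messages: the message set is [1:2^R], of size floor(2^R);
  message m is represented by basis index m-1.\<close>
definition num_msgs :: "real \<Rightarrow> nat" where
  "num_msgs R = nat \<lfloor>2 powr R\<rfloor>"

text \<open>(R,eps)-entanglement assisted code for the compound channel {N i}, i in [1:s],
  N i : A \<rightarrow> B with dims dA, dB.  Shared pure state |theta> on E_A E_B,
  encoder Enc : M E_A \<rightarrow> A, decoder Dec : B E_B \<rightarrow> M' (M' \<equiv> M).\<close>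
definition ea_code :: "nat \<Rightarrow> nat \<Rightarrow> nat \<Rightarrow> (nat \<Rightarrow> complex mat \<Rightarrow> complex mat) \<Rightarrow> real \<Rightarrow> real \<Rightarrow> bool" where
  "ea_code dA dB s N R eps \<longleftrightarrow>
     (let K = num_msgs R in
      \<exists>dEA dEB \<theta> Enc Dec.
        unit_vector (dEA * dEB) \<theta> \<and>
        is_channel (K * dEA) dA Enc \<and>
        is_channel (dB * dEB) K Dec \<and>
        (\<forall>m < K. \<forall>i \<in> {1..s}.
           let out = Dec (tensor_id dA dB dEB (N i)
                           (tensor_id (K * dEA) dA dEB Enc (kron (ket_bra K m) (proj \<theta>))))
           in Re (\<Sum>m' \<in> {..<K} - {m}. out $$ (m', m')) \<le> eps))"

end

theory Submission
  imports Defs "Jordan_Normal_Form.Determinant" "HOL-Library.FuncSet"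
begin

text \<open>
  Position-based coding. Alice and Bob share one copy of \<open>\<psi>\<close> per message, and Alice sends her half of
  copy \<open>m\<close>. Copy \<open>m\<close> then carries the channel output \<open>\<rho>\<^sup>i\<close>, while every other copy paired with
  Bob's output is in the product state \<open>\<rho>\<^sup>i\<^sub>B \<otimes> \<psi>\<^sub>A\<close>. Choosing \<open>\<sigma>\<^sub>B\<close> to be the average of the
  \<open>\<rho>\<^sup>i\<^sub>B\<close> in the hypothesis testing mutual informations yields tests \<open>M\<^sub>i\<close> that accept \<open>\<rho>\<^sup>i\<close> and
  reject all the product states. They are merged into a single test \<open>T (T + d)\<^sup>-\<^sup>1\<close> with
  \<open>T = \<Sum>\<^sub>i M\<^sub>i\<close>, which dominates every \<open>M\<^sub>i / (1 + d)\<close> and is dominated by \<open>T / d\<close>. Bob decodes by a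
  pretty-good-type measurement built from the copies \<open>\<Lambda>\<^sub>m\<close> of this test, with \<open>2 (1 + S)\<^sup>-\<^sup>1\<close>,
  \<open>S = \<Sum>\<^sub>m \<Lambda>\<^sub>m\<close>, in place of the usual \<open>S\<^sup>-\<^sup>1\<^sup>/\<^sup>2\<close>, so that neither square roots nor spectral
  decompositions are needed; the Hayashi-Nagaoka inequality still holds for it. The slack of the
  constants absorbs one bit, hence the maximum over \<open>\<psi>\<close> need not be attained.
\<close>

section \<open>Positive semidefinite forms on finite index sets\<close>

text \<open>One measurement has to serve every channel, and this fixes the error budget. A test that
  rejects the average of the s product states rejects each of them up to a factor s; adding the s
  tests into T loses a second factor s; passing from T to T (T + d)^-1 multiplies false alarms by
  1/d and adds d to the missed detections. With d = eta/2 and Hayashi-Nagaoka parameter eta, whose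
  coefficient 2 + eta + 1/eta is at most 4/eta, false alarms cost at most (4/eta) (2/eta) s^2 times
  the number of messages times the error level of the individual tests. For s >= 2 the penalty in
  the rate pays for this: with L = log (2s) >= 2 one has (eta / (6L))^(2L) <= eta^4 / (2s)^2. For s
  = 1 the exponent is only 2, too small to pay for 1/d, but then there is nothing to merge. The
  resolvent inequalities are verified on vectors written as phi = (T + d) v, where both sides become
  explicit quadratic forms in v; this replaces functional calculus.\<close>

definition inner_on :: "'i set \<Rightarrow> ('i \<Rightarrow> complex) \<Rightarrow> ('i \<Rightarrow> complex) \<Rightarrow> complex" where
  "inner_on I x y = (\<Sum>i\<in>I. cnj (x i) * y i)"

definition apply_on :: "'j set \<Rightarrow> ('i \<Rightarrow> 'j \<Rightarrow> complex) \<Rightarrow> ('j \<Rightarrow> complex) \<Rightarrow> 'i \<Rightarrow> complex" where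
  "apply_on I A y = (\<lambda>i. \<Sum>j\<in>I. A i j * y j)"

text \<open>Operators are functions on an arbitrary index set, so that a tensor product is a product
  of index sets and \<open>B A^K\<close> can be indexed by pairs of a number and a function.
  Matrices with their mixed-radix indices appear only where the given definitions require
  them.\<close>

definition form_on :: "'i set \<Rightarrow> ('i \<Rightarrow> 'i \<Rightarrow> complex) \<Rightarrow> ('i \<Rightarrow> complex) \<Rightarrow> ('i \<Rightarrow> complex) \<Rightarrow> complex" where
  "form_on I A x y = (\<Sum>i\<in>I. \<Sum>j\<in>I. cnj (x i) * A i j * y j)"

definition psd_on :: "'i set \<Rightarrow> ('i \<Rightarrow> 'i \<Rightarrow> complex) \<Rightarrow> bool" where
  "psd_on I A \<longleftrightarrow> (\<forall>v. form_on I A v v \<in> \<real> \<and> 0 \<le> Re (form_on I A v v))"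

definition delta :: "'i \<Rightarrow> 'i \<Rightarrow> complex" where
  "delta i j = (if i = j then 1 else 0)"

definition trace_on :: "'i set \<Rightarrow> ('i \<Rightarrow> 'i \<Rightarrow> complex) \<Rightarrow> ('i \<Rightarrow> 'i \<Rightarrow> complex) \<Rightarrow> complex" where
  "trace_on I P Y = (\<Sum>i\<in>I. \<Sum>j\<in>I. P i j * Y j i)"

lemma form_on_eq_inner: "form_on I A x y = inner_on I x (apply_on I A y)"
  by (simp add: form_on_def inner_on_def apply_on_def sum_distrib_left mult.assoc)

lemma form_on_cong:
  assumes "\<And>i. i \<in> I \<Longrightarrow> x i = x' i" "\<And>i. i \<in> I \<Longrightarrow> y i = y' i"
    and "\<And>i j. i \<in> I \<Longrightarrow> j \<in> I \<Longrightarrow> A i j = A' i j"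
  shows "form_on I A x y = form_on I A' x' y'"
  unfolding form_on_def using assms by (intro sum.cong) auto

lemma inner_on_cong:
  assumes "\<And>i. i \<in> I \<Longrightarrow> x i = x' i" "\<And>i. i \<in> I \<Longrightarrow> y i = y' i"
  shows "inner_on I x y = inner_on I x' y'"
  unfolding inner_on_def using assms by (intro sum.cong) auto

lemma psd_on_cong:
  assumes "\<And>i j. i \<in> I \<Longrightarrow> j \<in> I \<Longrightarrow> A i j = A' i j"
  shows "psd_on I A \<longleftrightarrow> psd_on I A'"
  unfolding psd_on_def using form_on_cong[of I _ _ _ _ A A'] assms by auto

lemma form_on_delta: "finite I \<Longrightarrow> form_on I delta x y = inner_on I x y"
  by (simp add: form_on_def inner_on_def delta_def if_distrib[of "\<lambda>c. _ * c"]
      if_distrib[of "\<lambda>c. c * _"] cong: if_cong)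

lemma form_on_add: "form_on I (\<lambda>i j. A i j + B i j) x y = form_on I A x y + form_on I B x y"
  by (simp add: form_on_def algebra_simps sum.distrib)

lemma form_on_diff: "form_on I (\<lambda>i j. A i j - B i j) x y = form_on I A x y - form_on I B x y"
  by (simp add: form_on_def algebra_simps sum_subtractf)

lemma form_on_scale: "form_on I (\<lambda>i j. c * A i j) x y = c * form_on I A x y"
  by (simp add: form_on_def algebra_simps sum_distrib_left)

lemma form_on_sum: "form_on I (\<lambda>i j. \<Sum>k\<in>S. A k i j) x y = (\<Sum>k\<in>S. form_on I (A k) x y)"
proof (induction S rule: infinite_finite_induct)
  case (insert k S)
  then show ?case by (simp add: form_on_add)
qed (simp_all add: form_on_def)

lemma form_on_add_left: "form_on I A (\<lambda>i. x i + y i) z = form_on I A x z + form_on I A y z"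
  by (simp add: form_on_def algebra_simps sum.distrib)

lemma form_on_add_right: "form_on I A z (\<lambda>i. x i + y i) = form_on I A z x + form_on I A z y"
  by (simp add: form_on_def algebra_simps sum.distrib)

lemma form_on_diff_left: "form_on I A (\<lambda>i. x i - y i) z = form_on I A x z - form_on I A y z"
  by (simp add: form_on_def algebra_simps sum_subtractf)

lemma form_on_diff_right: "form_on I A z (\<lambda>i. x i - y i) = form_on I A z x - form_on I A z y"
  by (simp add: form_on_def algebra_simps sum_subtractf)

lemma form_on_scale_left: "form_on I A (\<lambda>i. c * x i) z = cnj c * form_on I A x z"
  by (simp add: form_on_def algebra_simps sum_distrib_left)

lemma form_on_scale_right: "form_on I A z (\<lambda>i. c * x i) = c * form_on I A z x"
  by (simp add: form_on_def algebra_simps sum_distrib_left)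

lemmas form_on_bilinear = form_on_add_left form_on_add_right form_on_diff_left form_on_diff_right
  form_on_scale_left form_on_scale_right

lemma inner_on_sesquilinear:
  "inner_on I (\<lambda>i. x i + y i) z = inner_on I x z + inner_on I y z"
  "inner_on I z (\<lambda>i. x i + y i) = inner_on I z x + inner_on I z y"
  "inner_on I (\<lambda>i. x i - y i) z = inner_on I x z - inner_on I y z"
  "inner_on I z (\<lambda>i. x i - y i) = inner_on I z x - inner_on I z y"
  "inner_on I (\<lambda>i. c * x i) z = cnj c * inner_on I x z"
  "inner_on I z (\<lambda>i. c * x i) = c * inner_on I z x"
  by (simp_all add: inner_on_def algebra_simps sum.distrib sum_subtractf sum_distrib_left)

lemma inner_on_commute: "inner_on I y x = cnj (inner_on I x y)"
  by (simp add: inner_on_def mult.commute)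

lemma Re_inner_on_commute: "Re (inner_on I y x) = Re (inner_on I x y)"
  by (subst inner_on_commute) simp

lemma inner_on_self: "inner_on I x x = of_real (\<Sum>i\<in>I. (cmod (x i))\<^sup>2)"
  unfolding inner_on_def of_real_sum
  by (intro sum.cong refl) (simp add: complex_norm_square[symmetric] mult.commute del: of_real_power)

lemma psd_on_add: "psd_on I A \<Longrightarrow> psd_on I B \<Longrightarrow> psd_on I (\<lambda>i j. A i j + B i j)"
  by (simp add: psd_on_def form_on_add)

lemma psd_on_sum: "(\<And>k. k \<in> S \<Longrightarrow> psd_on I (A k)) \<Longrightarrow> psd_on I (\<lambda>i j. \<Sum>k\<in>S. A k i j)"
  by (simp add: psd_on_def form_on_sum sum_nonneg)

lemma psd_on_scale: "psd_on I A \<Longrightarrow> 0 \<le> c \<Longrightarrow> psd_on I (\<lambda>i j. of_real c * A i j)"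
  by (simp add: psd_on_def form_on_scale)

lemma psd_on_nonneg: "psd_on I A \<Longrightarrow> 0 \<le> Re (form_on I A v v)"
  by (simp add: psd_on_def)

lemma psd_on_real: "psd_on I A \<Longrightarrow> form_on I A v v \<in> \<real>"
  by (simp add: psd_on_def)

text \<open>Polarization: the form is real at \<open>x + c y\<close> for every \<open>c\<close>;
  \<open>c = 1\<close> compares the imaginary parts and \<open>c = \<i>\<close> the real parts.
  Hermiticity thus follows from real quadratic values.\<close>

lemma psd_on_form_commute:
  assumes "psd_on I A"
  shows "form_on I A y x = cnj (form_on I A x y)"
proof -
  have r: "form_on I A (\<lambda>i. x i + c * y i) (\<lambda>i. x i + c * y i) \<in> \<real>" for c
    using assms by (simp add: psd_on_def)
  have e: "Im (c * form_on I A x y + cnj c * form_on I A y x) = 0" for c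
    using r[of c] psd_on_real[OF assms, of x] psd_on_real[OF assms, of y]
    by (simp add: form_on_bilinear complex_is_Real_iff algebra_simps)
  show ?thesis
    using e[of 1] e[of \<i>] by (simp add: complex_eq_iff)
qed

lemma psd_on_Re_commute: "psd_on I A \<Longrightarrow> Re (form_on I A y x) = Re (form_on I A x y)"
  using psd_on_form_commute[of I A y x] by simp

lemma psd_on_hermitian:
  assumes "psd_on I A" "finite I" "i \<in> I" "j \<in> I"
  shows "A j i = cnj (A i j)"
proof -
  have *: "form_on I A (delta i) (delta j) = A i j" if "i \<in> I" "j \<in> I" for i j
    using that assms(2)
    by (simp add: form_on_def delta_def if_distrib[of cnj] if_distrib[of "\<lambda>c. _ * c"]
      if_distrib[of "\<lambda>c. c * _"] cong: if_cong)
  show ?thesis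
    using psd_on_form_commute[OF assms(1), of "delta j" "delta i"] *[of i j] *[of j i] assms by simp
qed

text \<open>Weighted Cauchy-Schwarz, from expanding the nonnegative form at \<open>c x - y\<close>.
  The free weight \<open>c\<close> is the source of both \<open>1 + d\<close> in the resolvent bound
  and \<open>2 + c + 1 / c\<close> in the Hayashi-Nagaoka inequality.\<close>

lemma psd_on_form_add_le:
  assumes P: "psd_on I P" and c: "0 < c"
  shows "Re (form_on I P (\<lambda>i. x i + y i) (\<lambda>i. x i + y i))
    \<le> (1 + c) * Re (form_on I P x x) + (1 + 1 / c) * Re (form_on I P y y)"
proof -
  have "0 \<le> Re (form_on I P (\<lambda>i. of_real c * x i - y i) (\<lambda>i. of_real c * x i - y i))"
    using P by (rule psd_on_nonneg)
  also have "\<dots> = c\<^sup>2 * Re (form_on I P x x) - 2 * c * Re (form_on I P x y) + Re (form_on I P y y)"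
    using psd_on_Re_commute[OF P, of y x]
    by (simp add: form_on_bilinear algebra_simps power2_eq_square)
  finally have "2 * c * Re (form_on I P x y) \<le> c * (c * Re (form_on I P x x) + Re (form_on I P y y) / c)"
    using c by (simp add: power2_eq_square algebra_simps)
  then have "2 * Re (form_on I P x y) \<le> c * Re (form_on I P x x) + Re (form_on I P y y) / c"
    using c by (simp add: mult.commute mult.left_commute)
  moreover have "Re (form_on I P (\<lambda>i. x i + y i) (\<lambda>i. x i + y i))
     = Re (form_on I P x x) + 2 * Re (form_on I P x y) + Re (form_on I P y y)"
    using psd_on_Re_commute[OF P, of y x] by (simp add: form_on_bilinear)
  ultimately show ?thesis by (simp add: algebra_simps)
qed

section \<open>Resolvents and the Hayashi-Nagaoka inequality\<close>

text \<open>This is M <= (1 + d) T (T + d)^-1 evaluated at \<open>\<phi>\<close> = (T + d) v. Split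
  \<open>\<phi>\<close> into T v and d v, use M <= 1 on the first piece and M <= T on the second;
  what remains recombines to the inner product of \<open>\<phi>\<close> with T v.\<close>

lemma resolvent_lower_bound:
  assumes T: "psd_on I T" and M: "psd_on I M" and M1: "psd_on I (\<lambda>i j. delta i j - M i j)"
    and TM: "psd_on I (\<lambda>i j. T i j - M i j)" and d: "0 < d" and I: "finite I"
    and \<phi>: "\<And>i. i \<in> I \<Longrightarrow> \<phi> i = apply_on I T v i + of_real d * v i"
  shows "Re (form_on I M \<phi> \<phi>) \<le> (1 + d) * Re (inner_on I \<phi> (apply_on I T v))"
proof -
  define a where "a = apply_on I T v"
  define dv where "dv = (\<lambda>i. of_real d * v i)"
  have "Re (form_on I M \<phi> \<phi>) = Re (form_on I M (\<lambda>i. a i + dv i) (\<lambda>i. a i + dv i))"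
    by (intro arg_cong[where f = Re] form_on_cong) (auto simp: \<phi> a_def dv_def)
  also have "\<dots> \<le> (1 + d) * Re (form_on I M a a) + (1 + 1 / d) * Re (form_on I M dv dv)"
    by (rule psd_on_form_add_le[OF M d])
  \<comment> \<open>The weight in the splitting was taken to be \<open>d\<close> because (1 + 1/d)
    d^2 = (1 + d) d, so that both pieces carry the same factor \<open>1 + d\<close>.\<close>
  also have "(1 + 1 / d) * Re (form_on I M dv dv) = (1 + d) * (d * Re (form_on I M v v))"
    using d by (simp add: dv_def form_on_bilinear field_simps)
  also have "(1 + d) * Re (form_on I M a a) + (1 + d) * (d * Re (form_on I M v v))
     \<le> (1 + d) * (Re (inner_on I a a) + d * Re (form_on I T v v))"
    using psd_on_nonneg[OF M1, of a] psd_on_nonneg[OF TM, of v] d I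
    by (simp add: form_on_diff form_on_delta distrib_left[symmetric] add_mono)
  also have "Re (inner_on I a a) + d * Re (form_on I T v v) = Re (inner_on I (\<lambda>i. a i + dv i) a)"
    by (simp add: inner_on_sesquilinear form_on_eq_inner a_def dv_def)
  also have "inner_on I (\<lambda>i. a i + dv i) a = inner_on I \<phi> a"
    by (intro inner_on_cong) (auto simp: \<phi> a_def dv_def)
  finally show ?thesis by (simp add: a_def)
qed

lemma apply_on_linear:
  "apply_on I A (\<lambda>i. x i + y i) = (\<lambda>i. apply_on I A x i + apply_on I A y i)"
  "apply_on I A (\<lambda>i. c * x i) = (\<lambda>i. c * apply_on I A x i)"
  by (auto simp: apply_on_def algebra_simps sum.distrib sum_distrib_left)

lemma apply_on_mult:
  "finite I \<Longrightarrow> apply_on I (\<lambda>i k. \<Sum>j\<in>I. A i j * B j k) x = apply_on I A (apply_on I B x)"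
  unfolding apply_on_def
  by (auto simp: sum_distrib_left sum_distrib_right mult.assoc intro: sum.swap)

lemma form_on_conjugate:
  "form_on J (\<lambda>x y. \<Sum>i\<in>I. \<Sum>k\<in>I. cnj (W i x) * A i k * W k y) v w
    = form_on I A (apply_on J W v) (apply_on J W w)"
proof -
  let ?t = "\<lambda>x y i k. cnj (W i x * v x) * A i k * (W k y * w y)"
  have "form_on J (\<lambda>x y. \<Sum>i\<in>I. \<Sum>k\<in>I. cnj (W i x) * A i k * W k y) v w
     = (\<Sum>x\<in>J. \<Sum>y\<in>J. \<Sum>i\<in>I. \<Sum>k\<in>I. ?t x y i k)"
    by (simp add: form_on_def sum_distrib_left sum_distrib_right algebra_simps)
  also have "\<dots> = (\<Sum>x\<in>J. \<Sum>i\<in>I. \<Sum>y\<in>J. \<Sum>k\<in>I. ?t x y i k)"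
    by (intro sum.cong refl sum.swap)
  also have "\<dots> = (\<Sum>i\<in>I. \<Sum>x\<in>J. \<Sum>y\<in>J. \<Sum>k\<in>I. ?t x y i k)"
    by (rule sum.swap)
  also have "\<dots> = (\<Sum>i\<in>I. \<Sum>x\<in>J. \<Sum>k\<in>I. \<Sum>y\<in>J. ?t x y i k)"
    by (intro sum.cong refl sum.swap)
  also have "\<dots> = (\<Sum>i\<in>I. \<Sum>k\<in>I. \<Sum>x\<in>J. \<Sum>y\<in>J. ?t x y i k)"
    by (intro sum.cong refl sum.swap)
  also have "\<dots> = form_on I A (apply_on J W v) (apply_on J W w)"
    unfolding form_on_def apply_on_def sum_distrib_left sum_distrib_right cnj_sum
    by (intro sum.cong refl sum.swap)
  finally show ?thesis .
qed

text \<open>\<open>V\<close> may be rectangular. Kraus maps, products with a second positive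
  operator and partial traces are all sums of such conjugations.\<close>

lemma psd_on_conjugate:
  "psd_on I A \<Longrightarrow> psd_on J (\<lambda>x y. \<Sum>i\<in>I. \<Sum>k\<in>I. V x i * A i k * cnj (V y k))"
  using form_on_conjugate[where J = J and I = I and A = A and W = "\<lambda>i x. cnj (V x i)"] by (simp add: psd_on_def)

text \<open>T + d is injective, since its form at x is at least d times the squared norm of x, and
  hence invertible in finite dimension. The determinant argument needs a matrix, so \<open>T\<close>
  is transported along an enumeration of \<open>I\<close>. Later uses require only that
  \<open>W\<close> is a right inverse.\<close>

lemma resolvent_exists:
  assumes T: "psd_on I T" and d: "0 < d" and I: "finite I"
  obtains W where "\<And>\<phi> i. i \<in> I \<Longrightarrow> \<phi> i = apply_on I T (apply_on I W \<phi>) i + of_real d * apply_on I W \<phi> i"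
proof -
  define n where "n = card I"
  obtain h where h: "bij_betw h {0..<n} I"
    using ex_bij_betw_nat_finite[OF I] n_def by auto
  define g where "g = the_inv_into {0..<n} h"
  have g: "\<And>i. i \<in> I \<Longrightarrow> g i < n" "\<And>i. i \<in> I \<Longrightarrow> h (g i) = i" "\<And>k. k < n \<Longrightarrow> g (h k) = k"
    using h unfolding g_def
    by (auto simp: bij_betw_def the_inv_into_f_f f_the_inv_into_f)
  have hI: "\<And>k. k < n \<Longrightarrow> h k \<in> I" using h by (auto simp: bij_betw_def)
  have sumI: "(\<Sum>i\<in>I. f i) = (\<Sum>k = 0..<n. f (h k))" for f :: "_ \<Rightarrow> complex"
    using sum.reindex_bij_betw[OF h] by metis
  define A where "A = mat n n (\<lambda>(k,l). T (h k) (h l) + of_real d * delta k l)"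
  have A: "A \<in> carrier_mat n n" by (simp add: A_def)
  have Amult: "(A *\<^sub>v v) $ k = apply_on I T (\<lambda>i. v $ g i) (h k) + of_real d * v $ k"
    if v: "v \<in> carrier_vec n" and k: "k < n" for v k
  proof -
    have "(A *\<^sub>v v) $ k = (\<Sum>l = 0..<n. (T (h k) (h l) + of_real d * delta k l) * v $ l)"
      using v k A by (simp add: scalar_prod_def A_def)
    also have "\<dots> = (\<Sum>l = 0..<n. T (h k) (h l) * v $ l) + (\<Sum>l = 0..<n. of_real d * delta k l * v $ l)"
      by (simp add: distrib_right sum.distrib)
    also have "(\<Sum>l = 0..<n. of_real d * delta k l * v $ l) = of_real d * v $ k"
      using k by (simp add: delta_def if_distrib[of "\<lambda>c. _ * c"] if_distrib[of "\<lambda>c. c * _"] cong: if_cong)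
    also have "(\<Sum>l = 0..<n. T (h k) (h l) * v $ l) = apply_on I T (\<lambda>i. v $ g i) (h k)"
      by (simp add: apply_on_def sumI g)
    finally show ?thesis .
  qed
  have "v = 0\<^sub>v n" if v: "v \<in> carrier_vec n" and 0: "A *\<^sub>v v = 0\<^sub>v n" for v
  proof -
    define x where "x = (\<lambda>i. v $ g i)"
    have z: "apply_on I T x i + of_real d * x i = 0" if "i \<in> I" for i
      using Amult[OF v, of "g i"] that 0 g by (simp add: x_def)
    have "inner_on I x (\<lambda>i. apply_on I T x i + of_real d * x i) = inner_on I x (\<lambda>i. 0)"
      by (intro inner_on_cong) (auto simp: z)
    then have "Re (form_on I T x x) + d * Re (inner_on I x x) = 0"
      by (simp add: inner_on_sesquilinear form_on_eq_inner complex_eq_iff) (simp add: inner_on_def)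
    moreover have "0 \<le> d * Re (inner_on I x x)" using d by (simp add: inner_on_self sum_nonneg)
    ultimately have "d * Re (inner_on I x x) = 0" using psd_on_nonneg[OF T, of x] by linarith
    then have "(\<Sum>i\<in>I. (cmod (x i))\<^sup>2) = 0" using d by (simp add: inner_on_self)
    then have "x i = 0" if "i \<in> I" for i using that I by (simp add: sum_nonneg_eq_0_iff)
    then have "v $ k = 0" if "k < n" for k using that hI g(3) by (fastforce simp: x_def)
    then show ?thesis using v by auto
  qed
  then have "det A \<noteq> 0" using det_0_iff_vec_prod_zero[OF A] by auto
  from det_non_zero_imp_unit[OF A this]
  obtain B where B: "B \<in> carrier_mat n n" "A * B = 1\<^sub>m n"
    by (auto simp: Units_def ring_mat_def)
  define W where "W = (\<lambda>i j. B $$ (g i, g j))"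
  show thesis
  proof (rule that)
    fix \<phi> :: "_ \<Rightarrow> complex" and i assume i: "i \<in> I"
    define p where "p = vec n (\<lambda>k. \<phi> (h k))"
    have p: "p \<in> carrier_vec n" by (simp add: p_def)
    have Bp: "(B *\<^sub>v p) $ g j = apply_on I W \<phi> j" if "j \<in> I" for j
      using that B g(1,3) by (simp add: apply_on_def sumI W_def p_def scalar_prod_def)
    have "A *\<^sub>v (B *\<^sub>v p) = p"
      using A B p by (metis assoc_mult_mat_vec one_mult_mat_vec)
    then have "\<phi> i = (A *\<^sub>v (B *\<^sub>v p)) $ g i" using g i by (simp add: p_def)
    also have "\<dots> = apply_on I T (\<lambda>i. (B *\<^sub>v p) $ g i) i + of_real d * (B *\<^sub>v p) $ g i"
      using Amult[of "B *\<^sub>v p" "g i"] B p g i by simp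
    also have "apply_on I T (\<lambda>i. (B *\<^sub>v p) $ g i) i = apply_on I T (apply_on I W \<phi>) i"
      unfolding apply_on_def[of I T] by (intro sum.cong refl) (simp add: Bp)
    finally show "\<phi> i = apply_on I T (apply_on I W \<phi>) i + of_real d * apply_on I W \<phi> i"
      using Bp[OF i] by simp
  qed
qed

text \<open>\<open>L\<close> is T (T + d)^-1. With v = W phi and a = T v, the forms of L, 1 - L and
  T - d L at phi are |a|^2 + d <v, T v>, d (<v, T v> + d |v|^2) and <a, T a> + d |a|^2, each visibly
  nonnegative.\<close>

lemma resolvent_union:
  assumes T: "psd_on I T" and d: "0 < d" and I: "finite I"
  obtains L where "psd_on I L" "psd_on I (\<lambda>i j. delta i j - L i j)"
    "psd_on I (\<lambda>i j. T i j - of_real d * L i j)"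
    "\<And>M. psd_on I M \<Longrightarrow> psd_on I (\<lambda>i j. delta i j - M i j) \<Longrightarrow> psd_on I (\<lambda>i j. T i j - M i j)
       \<Longrightarrow> psd_on I (\<lambda>i j. of_real (1 + d) * L i j - M i j)"
proof -
  obtain W where W: "\<And>\<phi> i. i \<in> I \<Longrightarrow>
      \<phi> i = apply_on I T (apply_on I W \<phi>) i + of_real d * apply_on I W \<phi> i"
    using resolvent_exists[OF T d I] by metis
  define L where "L = (\<lambda>i k. \<Sum>j\<in>I. T i j * W j k)"
  have L: "form_on I L \<phi> \<phi> = inner_on I \<phi> (apply_on I T (apply_on I W \<phi>))" for \<phi>
    by (simp add: form_on_eq_inner L_def apply_on_mult[OF I])
  have L': "form_on I L \<phi> \<phi> = inner_on I (apply_on I T v) (apply_on I T v) + of_real d * form_on I T v v"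
    and N: "inner_on I \<phi> \<phi> = form_on I L \<phi> \<phi> + of_real d * (form_on I T v v + of_real d * inner_on I v v)"
    and TT: "form_on I T \<phi> \<phi> = form_on I T a a + of_real (2 * d) * inner_on I a a
           + of_real (d\<^sup>2) * form_on I T v v"
    if v: "v = apply_on I W \<phi>" and a: "a = apply_on I T v" for \<phi> v a
  proof -
    let ?p = "\<lambda>i. apply_on I T v i + of_real d * v i"
    have p: "\<phi> i = ?p i" if "i \<in> I" for i using W[OF that, of \<phi>] v by simp
    have c: "inner_on I v (apply_on I T v) = inner_on I (apply_on I T v) v"
      using psd_on_form_commute[OF T, of v v] inner_on_commute[of I v "apply_on I T v"]
      by (simp add: form_on_eq_inner)
    have "form_on I L \<phi> \<phi> = inner_on I ?p (apply_on I T v)"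
      unfolding L v[symmetric] by (intro inner_on_cong) (auto simp: p)
    then show 1: "form_on I L \<phi> \<phi> = inner_on I (apply_on I T v) (apply_on I T v) + of_real d * form_on I T v v"
      by (simp add: inner_on_sesquilinear form_on_eq_inner)
    have "inner_on I \<phi> \<phi> = inner_on I ?p ?p" by (intro inner_on_cong) (auto simp: p)
    then show "inner_on I \<phi> \<phi> = form_on I L \<phi> \<phi> + of_real d * (form_on I T v v + of_real d * inner_on I v v)"
      unfolding 1 by (simp add: inner_on_sesquilinear form_on_eq_inner c algebra_simps)
    have "form_on I T \<phi> \<phi> = form_on I T ?p ?p" by (intro form_on_cong) (auto simp: p)
    also have "\<dots> = form_on I T a a + of_real d * (form_on I T a v + form_on I T v a)
         + of_real (d\<^sup>2) * form_on I T v v"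
      unfolding a[symmetric] by (simp add: form_on_bilinear algebra_simps power2_eq_square)
    also have "form_on I T a v = inner_on I a a" by (simp add: form_on_eq_inner a)
    also have "form_on I T v a = cnj (form_on I T a v)" by (rule psd_on_form_commute[OF T])
    also have "\<dots> = inner_on I a a" by (simp add: form_on_eq_inner a[symmetric] inner_on_self)
    finally show "form_on I T \<phi> \<phi> = form_on I T a a + of_real (2 * d) * inner_on I a a
           + of_real (d\<^sup>2) * form_on I T v v"
      by (simp add: algebra_simps)
  qed
  have Lr: "form_on I L \<phi> \<phi> \<in> \<real>" for \<phi>
    unfolding L'[OF refl refl] using psd_on_real[OF T] by (simp add: inner_on_self)
  have nn: "0 \<le> Re (inner_on I x x)" for x by (simp add: inner_on_self sum_nonneg)
  have 1: "psd_on I L"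
    using d nn psd_on_nonneg[OF T] Lr unfolding psd_on_def by (simp add: L'[OF refl refl])
  have 2: "psd_on I (\<lambda>i j. delta i j - L i j)"
    unfolding psd_on_def
  proof
    fix \<phi>
    show "form_on I (\<lambda>i j. delta i j - L i j) \<phi> \<phi> \<in> \<real> \<and>
        0 \<le> Re (form_on I (\<lambda>i j. delta i j - L i j) \<phi> \<phi>)"
      unfolding form_on_diff form_on_delta[OF I] N[OF refl refl, of \<phi>]
      using psd_on_real[OF T] psd_on_nonneg[OF T] nn d by (simp add: inner_on_self sum_nonneg)
  qed
  have 3: "psd_on I (\<lambda>i j. T i j - of_real d * L i j)"
  proof -
    have "form_on I (\<lambda>i j. T i j - of_real d * L i j) \<phi> \<phi>
       = form_on I T a a + of_real d * inner_on I a a" 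
      if "a = apply_on I T (apply_on I W \<phi>)" for \<phi> a
      unfolding form_on_diff form_on_scale L'[OF refl refl] TT[OF refl that] that[symmetric]
      by (simp add: algebra_simps power2_eq_square)
    then show ?thesis unfolding psd_on_def
      using psd_on_real[OF T] psd_on_nonneg[OF T] nn d by (simp add: inner_on_self)
  qed
  have 4: "psd_on I (\<lambda>i j. of_real (1 + d) * L i j - M i j)"
    if "psd_on I M" "psd_on I (\<lambda>i j. delta i j - M i j)" "psd_on I (\<lambda>i j. T i j - M i j)" for M
  proof -
    have "Re (form_on I M \<phi> \<phi>) \<le> (1 + d) * Re (form_on I L \<phi> \<phi>)" for \<phi>
      unfolding L by (rule resolvent_lower_bound[OF T that d I]) (rule W)
    then show ?thesis
      unfolding psd_on_def form_on_diff form_on_scale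
      using Lr psd_on_real[OF that(1)] Re_complex_of_real
      by (auto simp del: of_real_add)
  qed
  show thesis using that[OF 1 2 3 4] by blast
qed

text \<open>Write u = G phi and w = u - phi. Then S u = phi - w, whence |phi|^2 - <u, S u> = |w|^2:
  this gives the normalization, and it turns the form of 1 - Om_m into |w|^2 + <u, R u>, where R is
  the sum of the other operators. Splitting u = w + phi under R with weight \<open>c\<close> costs
  (1 + 1/c) <phi, R phi>, and the remaining terms in w are controlled by the resolvent bound for
  L_m.\<close>

lemma hayashi_nagaoka:
  fixes L :: "'m \<Rightarrow> 'i \<Rightarrow> 'i \<Rightarrow> complex"
  assumes I: "finite I" and K: "finite K" and c: "0 < c"
    and L: "\<And>m. m \<in> K \<Longrightarrow> psd_on I (L m)"
    and L1: "\<And>m. m \<in> K \<Longrightarrow> psd_on I (\<lambda>i j. delta i j - L m i j)"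
  obtains Om where "\<And>m. m \<in> K \<Longrightarrow> psd_on I (Om m)"
    "psd_on I (\<lambda>i j. delta i j - (\<Sum>m\<in>K. Om m i j))"
    "\<And>m. m \<in> K \<Longrightarrow> psd_on I (\<lambda>i j. of_real (1 + c) * (delta i j - L m i j)
        + of_real (2 + c + 1 / c) * (\<Sum>m'\<in>K - {m}. L m' i j) - (delta i j - Om m i j))"
proof -
  define S where "S = (\<lambda>i j. \<Sum>m\<in>K. L m i j)"
  have S: "psd_on I S" unfolding S_def by (rule psd_on_sum) (rule L)
  obtain W where W: "\<And>\<phi> i. i \<in> I \<Longrightarrow>
      \<phi> i = apply_on I S (apply_on I W \<phi>) i + of_real 1 * apply_on I W \<phi> i"
    using resolvent_exists[OF S _ I, of 1] by (metis (no_types, lifting) less_numeral_extra(1))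
  \<comment> \<open>\<open>Om m = G\<^sup>* L\<^sub>m G\<close> with \<open>G = 2 (1 + S)\<^sup>-\<^sup>1\<close>; the sum over \<open>m\<close> is at most 1 as \<open>4 x \<le> (1 + x)\<^sup>2\<close>.\<close>
  define Om where "Om = (\<lambda>m i l. 4 * (\<Sum>j\<in>I. \<Sum>k\<in>I. cnj (W j i) * L m j k * W k l))"
  define u where "u = (\<lambda>\<phi> i. 2 * apply_on I W \<phi> i)"
  have Om: "form_on I (Om m) \<phi> \<phi> = form_on I (L m) (u \<phi>) (u \<phi>)" for m \<phi>
    unfolding Om_def form_on_scale form_on_conjugate u_def form_on_bilinear by simp
  have SL: "form_on I S x y = (\<Sum>m\<in>K. form_on I (L m) x y)" for x y
    unfolding S_def by (rule form_on_sum)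
  \<comment> \<open>This is the Cayley transform (1 - S) (1 + S)^-1 applied to
    \<open>\<phi>\<close>.\<close>
  define w where "w = (\<lambda>\<phi> i. apply_on I W \<phi> i - apply_on I S (apply_on I W \<phi>) i)"
  have uw: "u \<phi> i = \<phi> i + w \<phi> i" and Suw: "apply_on I S (u \<phi>) i = \<phi> i - w \<phi> i" if "i \<in> I" for \<phi> i
    using W[OF that, of \<phi>] by (auto simp: u_def w_def apply_on_linear)
  have inn: "inner_on I \<phi> \<phi> - form_on I S (u \<phi>) (u \<phi>) = inner_on I (w \<phi>) (w \<phi>)" for \<phi>
  proof -
    have "form_on I S (u \<phi>) (u \<phi>) = inner_on I (\<lambda>i. \<phi> i + w \<phi> i) (\<lambda>i. \<phi> i - w \<phi> i)"
      unfolding form_on_eq_inner by (intro inner_on_cong) (simp_all add: uw Suw)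
    also have "Re \<dots> = Re (inner_on I \<phi> \<phi>) - Re (inner_on I (w \<phi>) (w \<phi>))"
      using Re_inner_on_commute[of I "w \<phi>" \<phi>] by (simp add: inner_on_sesquilinear)
    finally show ?thesis
      using psd_on_real[OF S, of "u \<phi>"] by (simp add: complex_eq_iff complex_is_Real_iff inner_on_self)
  qed
  have 1: "psd_on I (Om m)" if "m \<in> K" for m
    using L[OF that] by (simp add: psd_on_def Om)
  have 2: "psd_on I (\<lambda>i j. delta i j - (\<Sum>m\<in>K. Om m i j))"
    unfolding psd_on_def form_on_diff form_on_delta[OF I] form_on_sum Om SL[symmetric] inn
    by (simp add: inner_on_self sum_nonneg)
  have 3: "psd_on I (\<lambda>i j. of_real (1 + c) * (delta i j - L m i j)
        + of_real (2 + c + 1 / c) * (\<Sum>m'\<in>K - {m}. L m' i j) - (delta i j - Om m i j))"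
    if m: "m \<in> K" for m
  proof -
    define R where "R = (\<lambda>i j. \<Sum>m'\<in>K - {m}. L m' i j)"
    have R: "psd_on I R" unfolding R_def by (rule psd_on_sum) (use L in auto)
    have SR: "form_on I S x y = form_on I (L m) x y + form_on I R x y" for x y
      unfolding SL R_def form_on_sum using K m by (simp add: sum.remove)
    have TM: "psd_on I (\<lambda>i j. S i j - L m i j)"
      using R unfolding psd_on_def form_on_diff SR by simp
    have key: "Re (inner_on I \<phi> \<phi>) - Re (form_on I (L m) (u \<phi>) (u \<phi>))
       \<le> (1 + c) * (Re (inner_on I \<phi> \<phi>) - Re (form_on I (L m) \<phi> \<phi>))
          + (2 + c + 1 / c) * Re (form_on I R \<phi> \<phi>)" for \<phi>
    proof -
      let ?w = "w \<phi>" and ?u = "u \<phi>"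
      have uu: "Re (form_on I R ?u ?u) \<le> (1 + c) * Re (form_on I R ?w ?w) + (1 + 1 / c) * Re (form_on I R \<phi> \<phi>)"
      proof -
        have "form_on I R ?u ?u = form_on I R (\<lambda>i. ?w i + \<phi> i) (\<lambda>i. ?w i + \<phi> i)"
          by (intro form_on_cong) (simp_all add: uw)
        then show ?thesis using psd_on_form_add_le[OF R c, of ?w \<phi>] by simp
      qed
      have a: "Re (form_on I S ?w \<phi>) + Re (form_on I S ?w ?w) = Re (inner_on I \<phi> ?w) - Re (inner_on I ?w ?w)"
      proof -
        have "form_on I S ?w (\<lambda>i. \<phi> i + ?w i) = form_on I S ?w ?u"
          by (intro form_on_cong) (simp_all add: uw)
        also have "\<dots> = inner_on I ?w (\<lambda>i. \<phi> i - ?w i)"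
          unfolding form_on_eq_inner by (intro inner_on_cong) (simp_all add: Suw)
        finally have "Re (form_on I S ?w (\<lambda>i. \<phi> i + ?w i)) = Re (inner_on I ?w (\<lambda>i. \<phi> i - ?w i))"
          by simp
        then show ?thesis
          using Re_inner_on_commute[of I ?w \<phi>] by (simp add: form_on_bilinear inner_on_sesquilinear)
      qed
      have b: "Re (form_on I S \<phi> \<phi>) + Re (form_on I S ?w \<phi>) = Re (inner_on I \<phi> \<phi>) - Re (inner_on I \<phi> ?w)"
      proof -
        have "form_on I S \<phi> (\<lambda>i. \<phi> i + ?w i) = form_on I S \<phi> ?u"
          by (intro form_on_cong) (simp_all add: uw)
        also have "\<dots> = inner_on I \<phi> (\<lambda>i. \<phi> i - ?w i)"
          unfolding form_on_eq_inner by (intro inner_on_cong) (simp_all add: Suw)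
        finally have "Re (form_on I S \<phi> (\<lambda>i. \<phi> i + ?w i)) = Re (inner_on I \<phi> (\<lambda>i. \<phi> i - ?w i))"
          by simp
        then show ?thesis
          using psd_on_Re_commute[OF S, of ?w \<phi>] by (simp add: form_on_bilinear inner_on_sesquilinear)
      qed
      \<comment> \<open>The resolvent bound with d = 1, that is L_m <= 2 S (1 + S)^-1; the right
        side is 1 minus the Cayley transform.\<close>
      have res: "Re (form_on I (L m) \<phi> \<phi>) \<le> Re (inner_on I \<phi> \<phi>) - Re (inner_on I \<phi> ?w)"
      proof -
        have "Re (form_on I (L m) \<phi> \<phi>) \<le> (1 + 1) * Re (inner_on I \<phi> (apply_on I S (apply_on I W \<phi>)))"
          by (rule resolvent_lower_bound[OF S L[OF m] L1[OF m] TM _ I]) (use W in auto)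
        also have "\<dots> = Re (inner_on I \<phi> (apply_on I S ?u))"
          by (simp add: u_def apply_on_linear inner_on_sesquilinear)
        also have "inner_on I \<phi> (apply_on I S ?u) = inner_on I \<phi> (\<lambda>i. \<phi> i - ?w i)"
          by (intro inner_on_cong) (simp_all add: Suw)
        finally show ?thesis by (simp add: inner_on_sesquilinear)
      qed
      have w0: "0 \<le> Re (inner_on I ?w ?w)" "0 \<le> Re (form_on I (L m) ?w ?w)"
        using psd_on_nonneg[OF L[OF m]] by (auto simp: inner_on_self sum_nonneg)
      have inn': "Re (inner_on I \<phi> \<phi>) - Re (form_on I S ?u ?u) = Re (inner_on I ?w ?w)"
        using arg_cong[OF inn[of \<phi>], of Re] by simp
      \<comment> \<open>Facts \<open>a\<close> and \<open>b\<close> give |w|^2 + <w, S w> = 2 Re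
        <phi, w> - |phi|^2 + <phi, S phi>, and \<open>res\<close> bounds Re <phi, w> by |phi|^2 -
        <phi, L_m phi>. The second (1 + c) <phi, R phi> arises here from S = L_m + R.\<close>
      have "Re (inner_on I ?w ?w) + (1 + c) * Re (form_on I R ?w ?w)
         \<le> (1 + c) * (Re (inner_on I ?w ?w) + Re (form_on I S ?w ?w))"
        using w0 c by (simp add: SR algebra_simps)
      also have "\<dots> \<le> (1 + c) * (Re (inner_on I \<phi> \<phi>) - Re (form_on I (L m) \<phi> \<phi>) + Re (form_on I R \<phi> \<phi>))"
        using a b res c SR[of \<phi> \<phi>] by (intro mult_left_mono) auto
      finally have "Re (inner_on I ?w ?w) + (1 + c) * Re (form_on I R ?w ?w)
        \<le> (1 + c) * (Re (inner_on I \<phi> \<phi>) - Re (form_on I (L m) \<phi> \<phi>)) + (1 + c) * Re (form_on I R \<phi> \<phi>)"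
        by (simp add: distrib_left)
      moreover have "(2 + c + 1 / c) * Re (form_on I R \<phi> \<phi>)
         = (1 + c) * Re (form_on I R \<phi> \<phi>) + (1 + 1 / c) * Re (form_on I R \<phi> \<phi>)"
        by (simp add: distrib_right)
      ultimately show ?thesis using uu inn' SR[of ?u ?u] by simp
    qed
    show ?thesis
      unfolding R_def[symmetric] psd_on_def form_on_diff form_on_add form_on_scale form_on_delta[OF I] Om
      using key psd_on_real[OF R] psd_on_real[OF L[OF m]] 
      by (auto simp: complex_is_Real_iff inner_on_self simp del: of_real_add of_real_divide)
  qed
  show thesis using that[OF 1 2 3] by blast
qed

section \<open>Gram decompositions and traces\<close>

text \<open>Gaussian elimination: \<open>J\<close> is the set of indices not yet eliminated.\<close>

lemma psd_on_gram_aux: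
  assumes "finite I" "finite J" "J \<subseteq> I" "psd_on I A"
    and "\<And>i j. i \<in> I \<Longrightarrow> j \<in> I \<Longrightarrow> i \<notin> J \<or> j \<notin> J \<Longrightarrow> A i j = 0"
  shows "\<exists>w. \<forall>i\<in>I. \<forall>j\<in>I. A i j = (\<Sum>k\<in>J. w k i * cnj (w k j))"
  using assms(2-)
proof (induction J arbitrary: A rule: finite_induct)
  case empty
  then show ?case by auto
next
  case (insert n J)
  note I = \<open>finite I\<close>
  have n: "n \<in> I" using insert by auto
  note A = insert.prems(2)
  have herm: "A j i = cnj (A i j)" if "i \<in> I" "j \<in> I" for i j
    using psd_on_hermitian[OF A I that] .
  have fd: "form_on I A (delta n) x = apply_on I A x n" for x
    using n I unfolding form_on_eq_inner inner_on_def
    by (simp add: delta_def if_distrib[of cnj] if_distrib[of "\<lambda>c. c * _"] cong: if_cong)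
  have ad: "apply_on I A (delta n) i = A i n" for i
    using n I unfolding apply_on_def
    by (simp add: delta_def if_distrib[of "\<lambda>c. _ * c"] cong: if_cong)
  define a where "a = Re (A n n)"
  have Ann: "A n n = of_real a" "0 \<le> a"
    using psd_on_real[OF A, of "delta n"] psd_on_nonneg[OF A, of "delta n"]
    by (auto simp: fd ad a_def complex_is_Real_iff complex_eq_iff)
  have lin: "Re (form_on I A (\<lambda>i. x i + t * delta n i) (\<lambda>i. x i + t * delta n i))
     = Re (form_on I A x x) + 2 * Re (cnj t * apply_on I A x n) + (cmod t)\<^sup>2 * a" for x t
  proof -
    have "form_on I A x (delta n) = cnj (apply_on I A x n)"
      using psd_on_form_commute[OF A, of x "delta n"] by (simp add: fd)
    then show ?thesis
      unfolding cmod_power2 by (simp add: form_on_bilinear fd ad Ann power2_eq_square algebra_simps)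
  qed
  show ?case
  proof (cases "a = 0")
    case True
    have "A n j = 0" if j: "j \<in> I" for j
    proof -
      have dj: "apply_on I A (delta j) n = A n j" using j I unfolding apply_on_def
        by (simp add: delta_def if_distrib[of "\<lambda>c. _ * c"] cong: if_cong)
      define r where "r = Re (form_on I A (delta j) (delta j))"
      \<comment> \<open>With a zero diagonal entry the form along this direction is affine in
        \<open>s\<close>, hence nonnegative for all \<open>s\<close> only if the slope vanishes: a
        zero pivot has a zero row.\<close>
      have "0 \<le> r - 2 * s * (cmod (A n j))\<^sup>2" for s
      proof -
        let ?t = "- of_real s * A n j"
        have "0 \<le> Re (form_on I A (\<lambda>i. delta j i + ?t * delta n i) (\<lambda>i. delta j i + ?t * delta n i))"
          by (rule psd_on_nonneg[OF A])
        also have "\<dots> = r - 2 * s * (cmod (A n j))\<^sup>2"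
          unfolding lin dj r_def True cmod_power2 by (simp add: power2_eq_square algebra_simps)
        finally show ?thesis .
      qed
      \<comment> \<open>This value of \<open>s\<close> would make the expression equal to
        -1.\<close>
      from this[of "(r + 1) / (2 * (cmod (A n j))\<^sup>2)"] show ?thesis
        by (cases "A n j = 0") auto
    qed
    then have z: "A i j = 0" if "i \<in> I" "j \<in> I" "i \<notin> J \<or> j \<notin> J" for i j
      using insert.prems(3)[OF that(1,2)] herm[OF n that(1)] that n by (cases "i = n"; cases "j = n") auto
    obtain w where w: "\<forall>i\<in>I. \<forall>j\<in>I. A i j = (\<Sum>k\<in>J. w k i * cnj (w k j))"
      using insert.IH[OF _ A z] insert.prems(1) by blast
    have "A i j = (\<Sum>k\<in>insert n J. (w(n := \<lambda>_. 0)) k i * cnj ((w(n := \<lambda>_. 0)) k j))"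
      if "i \<in> I" "j \<in> I" for i j
      using w that insert.hyps by (auto intro!: sum.cong)
    then show ?thesis by blast
  next
    case False
    then have a: "0 < a" using Ann by simp
    \<comment> \<open>The Schur complement of the pivot: subtracting the rank-one term clears row
      and column \<open>n\<close>.\<close>
    define B where "B = (\<lambda>i j. A i j - A i n * A n j / of_real a)"
    have Bf: "form_on I B x x = form_on I A x x - of_real ((cmod (apply_on I A x n))\<^sup>2 / a)" for x
    proof -
      have "form_on I B x x = form_on I A x x - form_on I (\<lambda>i j. A i n * A n j / of_real a) x x"
        unfolding B_def by (rule form_on_diff)
      also have "form_on I (\<lambda>i j. A i n * A n j / of_real a) x x
         = (\<Sum>i\<in>I. cnj (x i) * A i n) * (\<Sum>j\<in>I. A n j * x j) / of_real a"
        unfolding form_on_def sum_product by (simp add: sum_divide_distrib algebra_simps)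
      also have "(\<Sum>i\<in>I. cnj (x i) * A i n) = cnj (apply_on I A x n)"
        unfolding apply_on_def cnj_sum by (intro sum.cong refl) (simp add: herm[OF n, symmetric])
      also have "(\<Sum>j\<in>I. A n j * x j) = apply_on I A x n" by (simp add: apply_on_def)
      finally show ?thesis
        unfolding of_real_divide complex_norm_square by (simp add: mult.commute)
    qed
    have B: "psd_on I B"
      unfolding psd_on_def
    proof (intro allI conjI)
      fix x
      show "form_on I B x x \<in> \<real>" unfolding Bf using psd_on_real[OF A] by simp
      \<comment> \<open>The shift along \<open>delta n\<close> that minimizes the form of
        \<open>A\<close>; the minimum is the form of the Schur complement.\<close>
      let ?t = "- (apply_on I A x n / of_real a)"
      have "0 \<le> Re (form_on I A (\<lambda>i. x i + ?t * delta n i) (\<lambda>i. x i + ?t * delta n i))"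
        by (rule psd_on_nonneg[OF A])
      also have "\<dots> = Re (form_on I A x x) - 2 * ((cmod (apply_on I A x n))\<^sup>2 / a) + (cmod (apply_on I A x n) / a)\<^sup>2 * a"
        unfolding lin using a cmod_power2[of "apply_on I A x n"]
        by (simp add: norm_divide power2_eq_square add_divide_distrib[symmetric])
      also have "\<dots> = Re (form_on I B x x)" unfolding Bf using a
        by (simp add: power2_eq_square power_divide field_simps)
      finally show "0 \<le> Re (form_on I B x x)" .
    qed
    have z: "B i j = 0" if "i \<in> I" "j \<in> I" "i \<notin> J \<or> j \<notin> J" for i j
    proof (cases "i = n \<or> j = n")
      case True
      then show ?thesis using a Ann by (auto simp: B_def)
    next
      case False
      then have "A i j = 0" "A i n = 0 \<or> A n j = 0"
        using insert.prems(3)[of i j] insert.prems(3)[of i n] insert.prems(3)[of n j] that n by auto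
      then show ?thesis by (auto simp: B_def)
    qed
    obtain w where w: "\<forall>i\<in>I. \<forall>j\<in>I. B i j = (\<Sum>k\<in>J. w k i * cnj (w k j))"
      using insert.IH[OF _ B z] insert.prems(1) by blast
    define w' where "w' = w(n := \<lambda>i. A i n / of_real (sqrt a))"
    have "A i j = (\<Sum>k\<in>insert n J. w' k i * cnj (w' k j))"
      if "i \<in> I" "j \<in> I" for i j
    proof -
      have "(\<Sum>k\<in>J. w' k i * cnj (w' k j)) = B i j"
        using w that insert.hyps by (auto simp: w'_def intro!: sum.cong)
      moreover have "w' n i * cnj (w' n j) = A i n * A n j / of_real a"
        using a herm[OF n that(2)] by (simp add: w'_def of_real_mult[symmetric] del: of_real_mult)
      ultimately show ?thesis using insert.hyps by (simp add: B_def)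
    qed
    then show ?thesis by blast
  qed
qed

lemma psd_on_gram:
  assumes "finite I" "psd_on I A"
  obtains w where "\<And>i j. i \<in> I \<Longrightarrow> j \<in> I \<Longrightarrow> A i j = (\<Sum>k\<in>I. w k i * cnj (w k j))"
  using psd_on_gram_aux[OF assms(1,1) subset_refl assms(2)] by blast

text \<open>The Gram vectors of \<open>P\<close> turn the trace into a sum of values of the form of
  \<open>Y\<close>.\<close>

lemma trace_on_nonneg:
  assumes I: "finite I" and P: "psd_on I P" and Y: "psd_on I Y"
  shows "trace_on I P Y \<in> \<real> \<and> 0 \<le> Re (trace_on I P Y)"
proof -
  obtain w where w: "\<And>i j. i \<in> I \<Longrightarrow> j \<in> I \<Longrightarrow> P i j = (\<Sum>k\<in>I. w k i * cnj (w k j))"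
    using psd_on_gram[OF I P] by blast
  have "trace_on I P Y = (\<Sum>i\<in>I. \<Sum>j\<in>I. \<Sum>k\<in>I. cnj (w k j) * Y j i * w k i)"
    unfolding trace_on_def
    by (intro sum.cong refl) (simp add: w sum_distrib_left sum_distrib_right algebra_simps)
  also have "\<dots> = (\<Sum>i\<in>I. \<Sum>k\<in>I. \<Sum>j\<in>I. cnj (w k j) * Y j i * w k i)"
    by (intro sum.cong refl sum.swap)
  also have "\<dots> = (\<Sum>k\<in>I. \<Sum>i\<in>I. \<Sum>j\<in>I. cnj (w k j) * Y j i * w k i)"
    by (rule sum.swap)
  also have "\<dots> = (\<Sum>k\<in>I. form_on I Y (w k) (w k))"
    unfolding form_on_def by (intro sum.cong refl sum.swap)
  finally show ?thesis
    using psd_on_real[OF Y] psd_on_nonneg[OF Y] by (simp add: sum_nonneg)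
qed

lemma trace_on_add: "trace_on I (\<lambda>i j. A i j + B i j) Y = trace_on I A Y + trace_on I B Y"
  by (simp add: trace_on_def algebra_simps sum.distrib)

lemma trace_on_diff: "trace_on I (\<lambda>i j. A i j - B i j) Y = trace_on I A Y - trace_on I B Y"
  by (simp add: trace_on_def algebra_simps sum_subtractf)

lemma trace_on_scale: "trace_on I (\<lambda>i j. c * A i j) Y = c * trace_on I A Y"
  by (simp add: trace_on_def algebra_simps sum_distrib_left)

lemma trace_on_sum: "trace_on I (\<lambda>i j. \<Sum>k\<in>S. A k i j) Y = (\<Sum>k\<in>S. trace_on I (A k) Y)"
proof (induction S rule: infinite_finite_induct)
  case (insert k S)
  then show ?case by (simp add: trace_on_add)
qed (simp_all add: trace_on_def)

lemma trace_on_delta: "finite I \<Longrightarrow> trace_on I delta Y = (\<Sum>i\<in>I. Y i i)"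
  by (simp add: trace_on_def delta_def if_distrib[of "\<lambda>c. c * _"] cong: if_cong)

lemma trace_on_cong:
  assumes "\<And>i j. i \<in> I \<Longrightarrow> j \<in> I \<Longrightarrow> A i j = A' i j" "\<And>i j. i \<in> I \<Longrightarrow> j \<in> I \<Longrightarrow> Y i j = Y' i j"
  shows "trace_on I A Y = trace_on I A' Y'"
  unfolding trace_on_def using assms by (intro sum.cong refl) auto

section \<open>Transport of forms and traces along bijections of index sets\<close>

lemma form_on_reindex:
  assumes "bij_betw e I J"
  shows "form_on J A x y = form_on I (\<lambda>i j. A (e i) (e j)) (x \<circ> e) (y \<circ> e)"
  unfolding form_on_def by (simp add: sum.reindex_bij_betw[OF assms, symmetric])

lemma trace_on_reindex:
  assumes "bij_betw e I J"
  shows "trace_on J A Y = trace_on I (\<lambda>i j. A (e i) (e j)) (\<lambda>i j. Y (e i) (e j))"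
  unfolding trace_on_def by (simp add: sum.reindex_bij_betw[OF assms, symmetric])

lemma psd_on_reindex:
  assumes e: "bij_betw e I J"
  shows "psd_on J A \<longleftrightarrow> psd_on I (\<lambda>i j. A (e i) (e j))"
proof
  show "psd_on I (\<lambda>i j. A (e i) (e j))" if "psd_on J A"
    unfolding psd_on_def
  proof
    fix v
    have "form_on I (\<lambda>i j. A (e i) (e j)) v v
       = form_on I (\<lambda>i j. A (e i) (e j)) ((v \<circ> the_inv_into I e) \<circ> e) ((v \<circ> the_inv_into I e) \<circ> e)"
      using e by (intro form_on_cong) (auto simp: bij_betw_def the_inv_into_f_f)
    then show "form_on I (\<lambda>i j. A (e i) (e j)) v v \<in> \<real> \<and> 0 \<le> Re (form_on I (\<lambda>i j. A (e i) (e j)) v v)"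
      using that unfolding form_on_reindex[OF e, symmetric] psd_on_def by simp
  qed
  show "psd_on J A" if "psd_on I (\<lambda>i j. A (e i) (e j))"
    using that unfolding psd_on_def form_on_reindex[OF e] by blast
qed

section \<open>Channels in Kraus form\<close>

lemma psd_iff_psd_on: "psd n A \<longleftrightarrow> A \<in> carrier_mat n n \<and> psd_on {..<n} (\<lambda>i j. A $$ (i, j))"
proof -
  let ?q = "form_on {..<n} (\<lambda>i j. A $$ (i, j))"
  have vec: "?q v v = ?q (($) (vec n v)) (($) (vec n v))" for v
    by (intro form_on_cong) auto
  have "psd n A \<longleftrightarrow> A \<in> carrier_mat n n \<and>
      (\<forall>v\<in>carrier_vec n. ?q (($) v) (($) v) \<in> \<real> \<and> 0 \<le> Re (?q (($) v) (($) v)))"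
    unfolding psd_def Let_def form_on_def ..
  also have "\<dots> \<longleftrightarrow> A \<in> carrier_mat n n \<and> (\<forall>v. ?q v v \<in> \<real> \<and> 0 \<le> Re (?q v v))"
    using vec vec_carrier[of n] by metis
  finally show ?thesis unfolding psd_on_def .
qed

lemma tr_mult_eq_trace_on:
  "A \<in> carrier_mat n n \<Longrightarrow> B \<in> carrier_mat n n \<Longrightarrow>
    tr (A * B) = trace_on {..<n} (\<lambda>i j. A $$ (i, j)) (\<lambda>i j. B $$ (i, j))"
  by (simp add: tr_def trace_on_def scalar_prod_def atLeast0LessThan)

lemma pair_index_less: "b < d \<Longrightarrow> j < k \<Longrightarrow> b * k + j < d * (k::nat)"
proof -
  assume "b < d" "j < k"
  then have "b * k + j < Suc b * k" by simp
  also have "\<dots> \<le> d * k" using \<open>b < d\<close> by (intro mult_le_mono1) simp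
  finally show ?thesis .
qed

lemma bij_betw_pair_index:
  "bij_betw (\<lambda>(b, j). b * k + j) ({..<d} \<times> {..<k}) {..<d * (k::nat)}"
proof (rule bij_betw_byWitness[where f' = "\<lambda>r. (r div k, r mod k)"])
  have "r mod k < k" if "r < d * k" for r using that by (cases "k = 0") auto
  then show "(\<lambda>r. (r div k, r mod k)) ` {..<d * k} \<subseteq> {..<d} \<times> {..<k}"
    by (auto simp: less_mult_imp_div_less)
qed (auto simp: pair_index_less)

lemma sum_times: "(\<Sum>x\<in>A \<times> B. f x) = (\<Sum>a\<in>A. \<Sum>b\<in>B. f (a, b))"
  for f :: "_ \<Rightarrow> 'a :: comm_monoid_add"
  by (simp add: sum.cartesian_product)

lemma sum_pair_index: "(\<Sum>r<d * k. f r) = (\<Sum>b<d. \<Sum>j<k. f (b * k + j))"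
  for f :: "nat \<Rightarrow> 'a :: comm_monoid_add"
proof -
  have "(\<Sum>r<d * k. f r) = (\<Sum>x\<in>{..<d} \<times> {..<k}. f ((\<lambda>(b, j). b * k + j) x))"
    by (rule sum.reindex_bij_betw[OF bij_betw_pair_index, symmetric])
  then show ?thesis by (simp add: sum_times)
qed

lemma sum_single:
  fixes g :: "_ \<Rightarrow> 'a :: comm_monoid_add"
  assumes "finite K" "j \<in> K" "\<And>x. x \<in> K \<Longrightarrow> x \<noteq> j \<Longrightarrow> g x = 0"
  shows "sum g K = g j"
  using assms by (subst sum.remove[of K j]) (auto intro!: sum.neutral)

definition kraus_map where
  "kraus_map dA dB S V X = mat dB dB (\<lambda>(b, b').
     \<Sum>\<kappa>\<in>S. \<Sum>a<dA. \<Sum>a'<dA. V \<kappa> b a * X $$ (a, a') * cnj (V \<kappa> b' a'))"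

text \<open>The hypothesis is the completeness relation for Kraus operators in conjugated form,
  which is equivalent as the identity has real entries. Complete positivity holds because tensoring
  with an identity yields a Kraus form again.\<close>

lemma is_channel_kraus_map:
  assumes S: "finite S"
    and V: "\<And>a a'. a < dA \<Longrightarrow> a' < dA \<Longrightarrow> (\<Sum>\<kappa>\<in>S. \<Sum>b<dB. V \<kappa> b a * cnj (V \<kappa> b a')) = delta a a'"
  shows "is_channel dA dB (kraus_map dA dB S V)"
  unfolding is_channel_def
proof (intro conjI ballI allI impI)
  fix X :: "complex mat" assume X: "X \<in> carrier_mat dA dA"
  show "kraus_map dA dB S V X \<in> carrier_mat dB dB" by (simp add: kraus_map_def)
  have "tr (kraus_map dA dB S V X)
      = (\<Sum>b<dB. \<Sum>\<kappa>\<in>S. \<Sum>a<dA. \<Sum>a'<dA. V \<kappa> b a * X $$ (a, a') * cnj (V \<kappa> b a'))"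
    by (simp add: tr_def kraus_map_def)
  also have "\<dots> = (\<Sum>\<kappa>\<in>S. \<Sum>b<dB. \<Sum>a<dA. \<Sum>a'<dA. V \<kappa> b a * X $$ (a, a') * cnj (V \<kappa> b a'))"
    by (rule sum.swap)
  also have "\<dots> = (\<Sum>\<kappa>\<in>S. \<Sum>a<dA. \<Sum>a'<dA. \<Sum>b<dB. V \<kappa> b a * X $$ (a, a') * cnj (V \<kappa> b a'))"
  proof (rule sum.cong[OF refl])
    fix \<kappa>
    have "(\<Sum>b<dB. \<Sum>a<dA. \<Sum>a'<dA. V \<kappa> b a * X $$ (a, a') * cnj (V \<kappa> b a'))
       = (\<Sum>a<dA. \<Sum>b<dB. \<Sum>a'<dA. V \<kappa> b a * X $$ (a, a') * cnj (V \<kappa> b a'))"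
      by (rule sum.swap)
    also have "\<dots> = (\<Sum>a<dA. \<Sum>a'<dA. \<Sum>b<dB. V \<kappa> b a * X $$ (a, a') * cnj (V \<kappa> b a'))"
      by (intro sum.cong refl sum.swap)
    finally show "(\<Sum>b<dB. \<Sum>a<dA. \<Sum>a'<dA. V \<kappa> b a * X $$ (a, a') * cnj (V \<kappa> b a')) = \<dots>" .
  qed
  also have "\<dots> = (\<Sum>a<dA. \<Sum>\<kappa>\<in>S. \<Sum>a'<dA. \<Sum>b<dB. V \<kappa> b a * X $$ (a, a') * cnj (V \<kappa> b a'))"
    by (rule sum.swap)
  also have "\<dots> = (\<Sum>a<dA. \<Sum>a'<dA. \<Sum>\<kappa>\<in>S. \<Sum>b<dB. V \<kappa> b a * X $$ (a, a') * cnj (V \<kappa> b a'))"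
    by (intro sum.cong refl sum.swap)
  also have "\<dots> = (\<Sum>a<dA. \<Sum>a'<dA. X $$ (a, a') * delta a a')"
    by (intro sum.cong refl) (simp add: V[symmetric] sum_distrib_left algebra_simps)
  also have "\<dots> = tr X"
    using X by (simp add: tr_def delta_def if_distrib[of "\<lambda>c. _ * c"] cong: if_cong)
  finally show "tr (kraus_map dA dB S V X) = tr X" .
  fix Y :: "complex mat" and c assume Y: "Y \<in> carrier_mat dA dA"
  show "kraus_map dA dB S V (c \<cdot>\<^sub>m X + Y) = c \<cdot>\<^sub>m kraus_map dA dB S V X + kraus_map dA dB S V Y"
  proof (rule eq_matI)
    fix b b' assume "b < dim_row (c \<cdot>\<^sub>m kraus_map dA dB S V X + kraus_map dA dB S V Y)"
      "b' < dim_col (c \<cdot>\<^sub>m kraus_map dA dB S V X + kraus_map dA dB S V Y)"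
    then have b: "b < dB" "b' < dB" by (simp_all add: kraus_map_def)
    have "(\<Sum>\<kappa>\<in>S. \<Sum>a<dA. \<Sum>a'<dA. V \<kappa> b a * (c \<cdot>\<^sub>m X + Y) $$ (a, a') * cnj (V \<kappa> b' a'))
      = (\<Sum>\<kappa>\<in>S. \<Sum>a<dA. \<Sum>a'<dA. c * (V \<kappa> b a * X $$ (a, a') * cnj (V \<kappa> b' a'))
           + V \<kappa> b a * Y $$ (a, a') * cnj (V \<kappa> b' a'))"
      using X Y by (intro sum.cong refl) (simp add: algebra_simps)
    then show "kraus_map dA dB S V (c \<cdot>\<^sub>m X + Y) $$ (b, b')
        = (c \<cdot>\<^sub>m kraus_map dA dB S V X + kraus_map dA dB S V Y) $$ (b, b')"
      using b by (simp add: kraus_map_def sum.distrib sum_distrib_left)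
  qed (simp_all add: kraus_map_def)
next
  fix k X assume "psd (dA * k) X"
  define IA where "IA = {..<dA} \<times> {..<k}"
  define IB where "IB = {..<dB} \<times> {..<k}"
  define X' where "X' = (\<lambda>(a, j) (a', j'). X $$ (a * k + j, a' * k + j'))"
  \<comment> \<open>The Kraus operators of the extended map, \<open>V\<close> tensored with the
    identity on the ancilla.\<close>
  define V' where "V' = (\<lambda>\<kappa> (b, j) (a, j'). V \<kappa> b a * delta j (j'::nat))"
  have X': "psd_on IA X'"
    using \<open>psd (dA * k) X\<close> psd_on_reindex[OF bij_betw_pair_index[of k dA], of "\<lambda>i j. X $$ (i, j)"]
    by (simp add: psd_iff_psd_on IA_def X'_def case_prod_unfold)
  have "psd_on IB (\<lambda>x y. \<Sum>\<kappa>\<in>S. \<Sum>i\<in>IA. \<Sum>l\<in>IA. V' \<kappa> x i * X' i l * cnj (V' \<kappa> y l))"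
    by (intro psd_on_sum psd_on_conjugate X')
  also have "?this \<longleftrightarrow> psd_on IB (\<lambda>x y. tensor_id dA dB k (kraus_map dA dB S V) X
       $$ ((\<lambda>(b, j). b * k + j) x, (\<lambda>(b, j). b * k + j) y))"
  proof (intro psd_on_cong)
    fix x y assume xy: "x \<in> IB" "y \<in> IB"
    obtain b j b' j' where e: "x = (b, j)" "y = (b', j')" by fastforce
    have b: "b < dB" "b' < dB" "j < k" "j' < k" using xy e by (auto simp: IB_def)
    have lt: "b * k + j < dB * k" "b' * k + j' < dB * k" using b by (auto intro: pair_index_less)
    have "tensor_id dA dB k (kraus_map dA dB S V) X $$ (b * k + j, b' * k + j')
      = (\<Sum>\<kappa>\<in>S. \<Sum>a<dA. \<Sum>a'<dA. V \<kappa> b a * X' (a, j) (a', j') * cnj (V \<kappa> b' a'))"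
      using b lt by (simp add: tensor_id_def kraus_map_def block_def X'_def)
    also have "\<dots> = (\<Sum>\<kappa>\<in>S. \<Sum>i\<in>IA. \<Sum>l\<in>IA. V' \<kappa> x i * X' i l * cnj (V' \<kappa> y l))"
    proof (intro sum.cong[OF refl])
      fix \<kappa>
      have 1: "(\<Sum>l\<in>IA. V' \<kappa> x i * X' i l * cnj (V' \<kappa> y l))
          = (\<Sum>a'<dA. V' \<kappa> x i * X' i (a', j') * cnj (V \<kappa> b' a'))" for i
        unfolding IA_def sum_times using b
        by (intro sum.cong[OF refl], subst sum_single[of _ j']) (auto simp: V'_def delta_def e)
      show "(\<Sum>a<dA. \<Sum>a'<dA. V \<kappa> b a * X' (a, j) (a', j') * cnj (V \<kappa> b' a'))
          = (\<Sum>i\<in>IA. \<Sum>l\<in>IA. V' \<kappa> x i * X' i l * cnj (V' \<kappa> y l))"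
        unfolding 1 unfolding IA_def sum_times using b
        by (intro sum.cong[OF refl], subst sum_single[of _ j]) (auto simp: V'_def delta_def e)
    qed
    finally show "(\<Sum>\<kappa>\<in>S. \<Sum>i\<in>IA. \<Sum>l\<in>IA. V' \<kappa> x i * X' i l * cnj (V' \<kappa> y l))
       = tensor_id dA dB k (kraus_map dA dB S V) X
       $$ ((\<lambda>(b, j). b * k + j) x, (\<lambda>(b, j). b * k + j) y)"
      by (simp add: e)
  qed
  finally show "psd (dB * k) (tensor_id dA dB k (kraus_map dA dB S V) X)"
    unfolding psd_iff_psd_on psd_on_reindex[OF bij_betw_pair_index[of k dB]] IB_def
    by (simp add: tensor_id_def)
qed

section \<open>Operators and states on many copies\<close>

lemma psd_on_tensor_delta:
  assumes L: "psd_on I L" and fin: "finite I" "finite G"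
  shows "psd_on (I \<times> G) (\<lambda>x y. L (fst x) (fst y) * delta (snd x) (snd y))"
proof -
  have "form_on (I \<times> G) (\<lambda>x y. L (fst x) (fst y) * delta (snd x) (snd y)) v v
     = (\<Sum>g\<in>G. form_on I L (\<lambda>i. v (i, g)) (\<lambda>i. v (i, g)))" for v
  proof -
    have "form_on (I \<times> G) (\<lambda>x y. L (fst x) (fst y) * delta (snd x) (snd y)) v v
       = (\<Sum>i\<in>I. \<Sum>g\<in>G. \<Sum>j\<in>I. cnj (v (i, g)) * L i j * v (j, g))"
      unfolding form_on_def sum_times using fin
      by (simp add: delta_def if_distrib[of "\<lambda>c. _ * c"] if_distrib[of "\<lambda>c. c * _"] cong: if_cong)
    also have "\<dots> = (\<Sum>g\<in>G. form_on I L (\<lambda>i. v (i, g)) (\<lambda>i. v (i, g)))"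
      unfolding form_on_def by (rule sum.swap)
    finally show ?thesis .
  qed
  then show ?thesis
    using L unfolding psd_on_def by (simp add: sum_nonneg)
qed

lemma trace_on_tensor_delta:
  assumes "finite I" "finite G"
  shows "trace_on (I \<times> G) (\<lambda>x y. L (fst x) (fst y) * delta (snd x) (snd y)) Y
     = trace_on I L (\<lambda>i j. \<Sum>g\<in>G. Y (i, g) (j, g))"
proof -
  have "trace_on (I \<times> G) (\<lambda>x y. L (fst x) (fst y) * delta (snd x) (snd y)) Y
     = (\<Sum>i\<in>I. \<Sum>g\<in>G. \<Sum>j\<in>I. L i j * Y (j, g) (i, g))"
    unfolding trace_on_def sum_times using assms
    by (simp add: delta_def if_distrib[of "\<lambda>c. _ * c"] if_distrib[of "\<lambda>c. c * _"] cong: if_cong)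
  also have "\<dots> = (\<Sum>i\<in>I. \<Sum>j\<in>I. \<Sum>g\<in>G. L i j * Y (j, g) (i, g))"
    by (intro sum.cong refl sum.swap)
  finally show ?thesis by (simp add: trace_on_def sum_distrib_left)
qed

text \<open>Basis vectors of \<open>B A\<^sup>K\<close> are pairs \<open>(b, f)\<close> with \<open>f k\<close> the basis index of copy \<open>k\<close>.\<close>

definition lift_on :: "nat set \<Rightarrow> nat \<Rightarrow> ('b \<times> 'a \<Rightarrow> 'b \<times> 'a \<Rightarrow> complex)
    \<Rightarrow> 'b \<times> (nat \<Rightarrow> 'a) \<Rightarrow> 'b \<times> (nat \<Rightarrow> 'a) \<Rightarrow> complex" where
  "lift_on K m L = (\<lambda>(b, f) (b', f').
     L (b, f m) (b', f' m) * (if \<forall>k\<in>K - {m}. f k = f' k then 1 else 0))"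

definition coded_state :: "nat set \<Rightarrow> nat \<Rightarrow> ('b \<times> 'a \<Rightarrow> 'b \<times> 'a \<Rightarrow> complex) \<Rightarrow> ('a \<Rightarrow> 'a \<Rightarrow> complex)
    \<Rightarrow> 'b \<times> (nat \<Rightarrow> 'a) \<Rightarrow> 'b \<times> (nat \<Rightarrow> 'a) \<Rightarrow> complex" where
  "coded_state K m \<rho> \<tau> = (\<lambda>(b, f) (b', f').
     \<rho> (b, f m) (b', f' m) * (\<Prod>k\<in>K - {m}. \<tau> (f k) (f' k)))"

lemma bij_betw_PiE_upd:
  assumes "m \<in> K"
  shows "bij_betw (\<lambda>(a, g). g(m := a)) (A \<times> PiE (K - {m}) (\<lambda>_. A)) (PiE K (\<lambda>_. A))"
proof -
  have K: "insert m (K - {m}) = K" using assms by auto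
  have "inj_on (\<lambda>(a, g). g(m := a)) (A \<times> PiE (K - {m}) (\<lambda>_. A))"
    using inj_combinator[of m "K - {m}" "\<lambda>_. A"] by simp
  moreover have "(\<lambda>(a, g). g(m := a)) ` (A \<times> PiE (K - {m}) (\<lambda>_. A)) = PiE K (\<lambda>_. A)"
    using PiE_insert_eq[of m "K - {m}" "\<lambda>_. A"] unfolding K by simp
  ultimately show ?thesis by (simp add: bij_betw_def)
qed

text \<open>Regroups B A^K so that copy \<open>m\<close> stands next to B. Under this bijection a
  lifted operator becomes L tensored with the identity on the other copies.\<close>

lemma bij_betw_times_PiE_upd:
  assumes "m \<in> K"
  shows "bij_betw (\<lambda>x. (fst (fst x), (snd x)(m := snd (fst x))))
     ((B \<times> A) \<times> PiE (K - {m}) (\<lambda>_. A)) (B \<times> PiE K (\<lambda>_. A))"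
proof -
  let ?e = "\<lambda>x. (fst (fst x), (snd x)(m := snd (fst x)))" and ?G = "PiE (K - {m}) (\<lambda>_. A)"
  have inj: "g = g' \<and> a = a'" if "g(m := a) = g'(m := a')" "g \<in> ?G" "g' \<in> ?G" "a \<in> A" "a' \<in> A" for g g' a a'
    using bij_betw_PiE_upd[OF assms, of A] that unfolding bij_betw_def inj_on_def by auto
  have im: "(\<lambda>(a, g). g(m := a)) ` (A \<times> ?G) = PiE K (\<lambda>_. A)"
    using bij_betw_PiE_upd[OF assms, of A] by (simp add: bij_betw_def)
  have "inj_on ?e ((B \<times> A) \<times> ?G)"
  proof (rule inj_onI)
    fix x y assume xy: "x \<in> (B \<times> A) \<times> ?G" "y \<in> (B \<times> A) \<times> ?G" and "?e x = ?e y"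
    then have "fst (fst x) = fst (fst y)" "(snd x)(m := snd (fst x)) = (snd y)(m := snd (fst y))"
      by simp_all
    with inj[OF this(2)] xy show "x = y" by (simp add: prod_eq_iff mem_Times_iff)
  qed
  moreover have "?e ` ((B \<times> A) \<times> ?G) = B \<times> PiE K (\<lambda>_. A)"
  proof (intro equalityI subsetI)
    fix y assume "y \<in> B \<times> PiE K (\<lambda>_. A)"
    then obtain a g where "fst y \<in> B" "a \<in> A" "g \<in> ?G" "snd y = g(m := a)"
      unfolding im[symmetric] by auto
    then show "y \<in> ?e ` ((B \<times> A) \<times> ?G)"
      by (intro image_eqI[of _ _ "((fst y, a), g)"]) (auto simp: prod_eq_iff)
  next
    fix y assume "y \<in> ?e ` ((B \<times> A) \<times> ?G)"
    then obtain b a g where "b \<in> B" "a \<in> A" "g \<in> ?G" "y = (b, g(m := a))" by auto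
    moreover have "g(m := a) \<in> PiE K (\<lambda>_. A)" unfolding im[symmetric]
      using \<open>a \<in> A\<close> \<open>g \<in> ?G\<close> by (intro image_eqI[of _ _ "(a, g)"]) auto
    ultimately show "y \<in> B \<times> PiE K (\<lambda>_. A)" by simp
  qed
  ultimately show ?thesis by (simp add: bij_betw_def)
qed

lemma lift_on_upd:
  assumes "g \<in> PiE (K - {m}) (\<lambda>_. A)" "g' \<in> PiE (K - {m}) (\<lambda>_. A)"
  shows "lift_on K m L (b, g(m := a)) (b', g'(m := a')) = L (b, a) (b', a') * delta g g'"
proof -
  have "(\<forall>k\<in>K - {m}. (g(m := a)) k = (g'(m := a')) k) \<longleftrightarrow> g = g'"
    using PiE_ext[OF assms] by auto
  then show ?thesis by (simp add: lift_on_def delta_def)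
qed

lemma psd_on_lift:
  assumes L: "psd_on (B \<times> A) L" and fin: "finite B" "finite A" "finite K" and m: "m \<in> K"
  shows "psd_on (B \<times> PiE K (\<lambda>_. A)) (lift_on K m L)"
proof -
  let ?G = "PiE (K - {m}) (\<lambda>_. A)"
  have "psd_on ((B \<times> A) \<times> ?G) (\<lambda>x y. L (fst x) (fst y) * delta (snd x) (snd y))"
    using fin by (intro psd_on_tensor_delta L finite_cartesian_product finite_PiE) auto
  also have "?this \<longleftrightarrow> psd_on ((B \<times> A) \<times> ?G) (\<lambda>x y. lift_on K m L
      (fst (fst x), (snd x)(m := snd (fst x))) (fst (fst y), (snd y)(m := snd (fst y))))"
    by (intro psd_on_cong) (simp add: lift_on_upd[where A = A] mem_Times_iff)
  finally show ?thesis
    unfolding psd_on_reindex[OF bij_betw_times_PiE_upd[OF m]] .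
qed

text \<open>Lifting is linear and unital. The equality needs extensional functions, since
  \<open>delta\<close> compares whole functions and the lift only their values on
  \<open>K\<close>.\<close>

lemma lift_on_complement:
  assumes "m \<in> K" and xy: "x \<in> B \<times> PiE K (\<lambda>_. A)" "y \<in> B \<times> PiE K (\<lambda>_. A)"
  shows "delta x y - lift_on K m L x y = lift_on K m (\<lambda>i j. delta i j - L i j) x y"
proof -
  have "snd x = snd y \<longleftrightarrow> (\<forall>k\<in>K. snd x k = snd y k)"
    using PiE_ext[of "snd x" K "\<lambda>_. A" "snd y"] xy by (auto simp: mem_Times_iff)
  also have "\<dots> \<longleftrightarrow> snd x m = snd y m \<and> (\<forall>k\<in>K - {m}. snd x k = snd y k)"
    using \<open>m \<in> K\<close> by blast
  finally show ?thesis
    by (simp add: lift_on_def delta_def case_prod_unfold prod_eq_iff)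
qed

lemma psd_on_lift_complement:
  assumes L: "psd_on (B \<times> A) (\<lambda>i j. delta i j - L i j)"
    and fin: "finite B" "finite A" "finite K" and m: "m \<in> K"
  shows "psd_on (B \<times> PiE K (\<lambda>_. A)) (\<lambda>i j. delta i j - lift_on K m L i j)"
proof -
  have "psd_on (B \<times> PiE K (\<lambda>_. A)) (\<lambda>i j. delta i j - lift_on K m L i j)
      \<longleftrightarrow> psd_on (B \<times> PiE K (\<lambda>_. A)) (lift_on K m (\<lambda>i j. delta i j - L i j))"
    by (rule psd_on_cong) (rule lift_on_complement[OF m])
  with psd_on_lift[OF L fin m] show ?thesis by simp
qed

lemma trace_on_lift:
  assumes fin: "finite B" "finite A" "finite K" and m: "m \<in> K"
  shows "trace_on (B \<times> PiE K (\<lambda>_. A)) (lift_on K m L) Y = trace_on (B \<times> A) L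
     (\<lambda>i j. \<Sum>g\<in>PiE (K - {m}) (\<lambda>_. A). Y (fst i, g(m := snd i)) (fst j, g(m := snd j)))"
proof -
  let ?G = "PiE (K - {m}) (\<lambda>_. A)"
  have "trace_on (B \<times> PiE K (\<lambda>_. A)) (lift_on K m L) Y
     = trace_on ((B \<times> A) \<times> ?G) (\<lambda>x y. L (fst x) (fst y) * delta (snd x) (snd y))
        (\<lambda>x y. Y (fst (fst x), (snd x)(m := snd (fst x))) (fst (fst y), (snd y)(m := snd (fst y))))"
    unfolding trace_on_reindex[OF bij_betw_times_PiE_upd[OF m]]
    by (intro trace_on_cong) (simp_all add: lift_on_upd[where A = A] mem_Times_iff)
  also have "\<dots> = trace_on (B \<times> A) L
     (\<lambda>i j. \<Sum>g\<in>?G. Y (fst i, g(m := snd i)) (fst j, g(m := snd j)))"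
    by (subst trace_on_tensor_delta) (use fin in \<open>auto intro!: finite_PiE\<close>)
  finally show ?thesis .
qed

lemma trace_on_lift_coded_state_same:
  assumes fin: "finite B" "finite A" "finite K" and m: "m \<in> K" and \<tau>: "(\<Sum>a\<in>A. \<tau> a a) = 1"
  shows "trace_on (B \<times> PiE K (\<lambda>_. A)) (lift_on K m L) (coded_state K m \<rho> \<tau>) = trace_on (B \<times> A) L \<rho>"
proof -
  have "(\<Sum>g\<in>PiE (K - {m}) (\<lambda>_. A). \<Prod>k\<in>K - {m}. \<tau> (g k) (g k)) = 1"
    using prod_sum_PiE[of "K - {m}" "\<lambda>_. A" "\<lambda>_ a. \<tau> a a"] fin \<tau> by simp
  then show ?thesis
    unfolding trace_on_lift[OF fin m]
    by (intro trace_on_cong refl) (simp add: coded_state_def sum_distrib_left[symmetric])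
qed

text \<open>A test at a wrong position sees B and a copy independent of it: tracing out position
  \<open>m\<close> leaves the B-marginal of \<open>\<rho>\<close>, and position \<open>m'\<close>
  contributes a factor \<open>\<tau>\<close>.\<close>

lemma trace_on_lift_coded_state_other:
  assumes fin: "finite B" "finite A" "finite K" and m: "m \<in> K" "m' \<in> K" "m' \<noteq> m"
    and \<tau>: "(\<Sum>a\<in>A. \<tau> a a) = 1"
  shows "trace_on (B \<times> PiE K (\<lambda>_. A)) (lift_on K m' L) (coded_state K m \<rho> \<tau>)
     = trace_on (B \<times> A) L (\<lambda>i j. (\<Sum>a\<in>A. \<rho> (fst i, a) (fst j, a)) * \<tau> (snd i) (snd j))"
  unfolding trace_on_lift[OF fin m(2)]
proof (intro trace_on_cong refl)
  fix i j assume "i \<in> B \<times> A" "j \<in> B \<times> A"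
  \<comment> \<open>The summand factorizes over the positions other than \<open>m'\<close>, with
    \<open>F k\<close> as factor \<open>k\<close>, so the sum over functions becomes a product of
    sums.\<close>
  define F where "F = (\<lambda>k a. if k = m then \<rho> (fst i, a) (fst j, a) else \<tau> a a)"
  let ?G = "PiE (K - {m'}) (\<lambda>_. A)"
  have "coded_state K m \<rho> \<tau> (fst i, g(m' := snd i)) (fst j, g(m' := snd j))
     = \<tau> (snd i) (snd j) * (\<Prod>k\<in>K - {m'}. F k (g k))" for g
  proof -
    define J where "J = K - {m, m'}"
    have e: "K - {m} = insert m' J" "K - {m'} = insert m J" using m by (auto simp: J_def)
    have J: "finite J" "m \<notin> J" "m' \<notin> J" using fin by (auto simp: J_def)
    have p: "(\<Prod>k\<in>J. \<tau> ((g(m' := snd i)) k) ((g(m' := snd j)) k)) = (\<Prod>k\<in>J. \<tau> (g k) (g k))"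
      "(\<Prod>k\<in>J. F k (g k)) = (\<Prod>k\<in>J. \<tau> (g k) (g k))"
      using J by (intro prod.cong refl; force simp: F_def)+
    have "(\<Prod>k\<in>K - {m}. \<tau> ((g(m' := snd i)) k) ((g(m' := snd j)) k))
       = \<tau> (snd i) (snd j) * (\<Prod>k\<in>J. \<tau> (g k) (g k))"
      unfolding e prod.insert[OF J(1,3)] p by simp
    moreover have "(\<Prod>k\<in>K - {m'}. F k (g k))
       = \<rho> (fst i, g m) (fst j, g m) * (\<Prod>k\<in>J. \<tau> (g k) (g k))"
      unfolding e prod.insert[OF J(1,2)] p by (simp add: F_def)
    ultimately show ?thesis using m by (simp add: coded_state_def)
  qed
  then have "(\<Sum>g\<in>?G. coded_state K m \<rho> \<tau> (fst i, g(m' := snd i)) (fst j, g(m' := snd j)))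
     = \<tau> (snd i) (snd j) * (\<Sum>g\<in>?G. \<Prod>k\<in>K - {m'}. F k (g k))"
    by (simp add: sum_distrib_left)
  also have "(\<Sum>g\<in>?G. \<Prod>k\<in>K - {m'}. F k (g k)) = (\<Prod>k\<in>K - {m'}. \<Sum>a\<in>A. F k a)"
    using fin by (intro prod_sum_PiE[symmetric]) auto
  also have "\<dots> = (\<Prod>k\<in>K - {m'}. if k = m then \<Sum>a\<in>A. \<rho> (fst i, a) (fst j, a) else 1)"
    using \<tau> by (intro prod.cong refl) (simp add: F_def)
  also have "\<dots> = (\<Sum>a\<in>A. \<rho> (fst i, a) (fst j, a))"
    using fin m by simp
  finally show "(\<Sum>g\<in>?G. coded_state K m \<rho> \<tau> (fst i, g(m' := snd i)) (fst j, g(m' := snd j)))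
     = (\<Sum>a\<in>A. \<rho> (fst i, a) (fst j, a)) * \<tau> (snd i) (snd j)"
    by (subst mult.commute)
qed

text \<open>Linearity is given in the combined form \<open>c X + Y\<close>, so a zero image of the
  zero matrix has to come first; it follows from \<open>c = -1\<close>.\<close>

lemma channel_scale:
  assumes "is_channel dA dB \<Phi>" "X \<in> carrier_mat dA dA"
  shows "\<Phi> (c \<cdot>\<^sub>m X) = c \<cdot>\<^sub>m \<Phi> X"
proof -
  have carr: "\<Phi> Z \<in> carrier_mat dB dB" if "Z \<in> carrier_mat dA dA" for Z
    using assms(1) that by (simp add: is_channel_def)
  have lin: "\<Phi> (c \<cdot>\<^sub>m Z + Z') = c \<cdot>\<^sub>m \<Phi> Z + \<Phi> Z'"
    if "Z \<in> carrier_mat dA dA" "Z' \<in> carrier_mat dA dA" for c Z Z'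
    using assms(1) that by (simp add: is_channel_def)
  let ?z = "0\<^sub>m dA dA :: complex mat"
  have zz: "?z \<in> carrier_mat dA dA" by simp
  have "\<Phi> ((-1) \<cdot>\<^sub>m ?z + ?z) = (-1) \<cdot>\<^sub>m \<Phi> ?z + \<Phi> ?z" by (rule lin) auto
  then have "\<Phi> ?z = 0\<^sub>m dB dB" using carr[OF zz] by (auto simp: mat_eq_iff)
  then show ?thesis
    using lin[OF assms(2) zz, of c] carr[OF assms(2)] assms(2) by simp
qed

text \<open>The Kraus operators are |m><w|, with w running through the Gram vectors of
  \<open>Om m\<close>. Only the diagonal of the output is described, as the error probability reads
  nothing else.\<close>

lemma measurement_channel:
  assumes Om: "\<And>m. m < K \<Longrightarrow> psd_on {..<n} (Om m)"
    and sum1: "\<And>i j. i < n \<Longrightarrow> j < n \<Longrightarrow> (\<Sum>m<K. Om m i j) = delta i j"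
  obtains Dec where "is_channel n K Dec"
    "\<And>Y m. m < K \<Longrightarrow> Dec Y $$ (m, m) = trace_on {..<n} (Om m) (\<lambda>i j. Y $$ (i, j))"
proof -
  have "\<exists>w. \<forall>i<n. \<forall>j<n. Om m i j = (\<Sum>k<n. w k i * cnj (w k j))" if "m < K" for m
    using psd_on_gram[OF finite_lessThan Om[OF that]] by (metis lessThan_iff)
  then obtain w where w: "\<And>m i j. m < K \<Longrightarrow> i < n \<Longrightarrow> j < n \<Longrightarrow>
      Om m i j = (\<Sum>k<n. w m k i * cnj (w m k j))"
    by metis
  define V where "V = (\<lambda>(m, k::nat) b a. if b = m then cnj (w m k a) else (0::complex))"
  let ?S = "{..<K} \<times> {..<n}"
  have "is_channel n K (kraus_map n K ?S V)"
  proof (rule is_channel_kraus_map)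
    fix a a' assume a: "a < n" "a' < n"
    have "(\<Sum>\<kappa>\<in>?S. \<Sum>b<K. V \<kappa> b a * cnj (V \<kappa> b a'))
       = (\<Sum>m<K. \<Sum>k<n. \<Sum>b<K. V (m, k) b a * cnj (V (m, k) b a'))"
      by (rule sum_times)
    also have "\<dots> = (\<Sum>m<K. \<Sum>k<n. w m k a' * cnj (w m k a))"
    proof (intro sum.cong[OF refl])
      fix m k assume "m \<in> {..<K}"
      then show "(\<Sum>b<K. V (m, k) b a * cnj (V (m, k) b a')) = w m k a' * cnj (w m k a)"
        by (subst sum_single[of _ m]) (auto simp: V_def)
    qed
    also have "\<dots> = (\<Sum>m<K. Om m a' a)" using a by (intro sum.cong refl) (simp add: w)
    also have "\<dots> = delta a a'" using a sum1 by (auto simp: delta_def)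
    finally show "(\<Sum>\<kappa>\<in>?S. \<Sum>b<K. V \<kappa> b a * cnj (V \<kappa> b a')) = delta a a'" .
  qed auto
  moreover have "kraus_map n K ?S V Y $$ (m, m) = trace_on {..<n} (Om m) (\<lambda>i j. Y $$ (i, j))"
    if m: "m < K" for Y m
  proof -
    have "kraus_map n K ?S V Y $$ (m, m)
       = (\<Sum>m'<K. \<Sum>k<n. \<Sum>a<n. \<Sum>a'<n. V (m', k) m a * Y $$ (a, a') * cnj (V (m', k) m a'))"
      using m by (simp add: kraus_map_def sum_times)
    also have "\<dots> = (\<Sum>k<n. \<Sum>a<n. \<Sum>a'<n. cnj (w m k a) * Y $$ (a, a') * w m k a')"
      using m by (subst sum_single[of _ m]) (auto simp: V_def)
    also have "\<dots> = (\<Sum>a<n. \<Sum>k<n. \<Sum>a'<n. cnj (w m k a) * Y $$ (a, a') * w m k a')"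
      by (rule sum.swap)
    also have "\<dots> = (\<Sum>a<n. \<Sum>a'<n. \<Sum>k<n. cnj (w m k a) * Y $$ (a, a') * w m k a')"
      by (intro sum.cong[OF refl] sum.swap)
    also have "\<dots> = (\<Sum>a<n. \<Sum>a'<n. Om m a' a * Y $$ (a, a'))"
      using m by (intro sum.cong[OF refl]) (simp add: w sum_distrib_left sum_distrib_right algebra_simps)
    also have "\<dots> = trace_on {..<n} (Om m) (\<lambda>i j. Y $$ (i, j))"
      unfolding trace_on_def by (rule sum.swap)
    finally show ?thesis .
  qed
  ultimately show thesis by (rule that)
qed

lemma sum_PiE_upd:
  fixes F :: "_ \<Rightarrow> 'c :: comm_monoid_add"
  assumes "m \<in> K"
  shows "(\<Sum>g\<in>PiE (K - {m}) (\<lambda>_. A). \<Sum>a\<in>A. F (g(m := a))) = (\<Sum>f\<in>PiE K (\<lambda>_. A). F f)"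
proof -
  have "(\<Sum>f\<in>PiE K (\<lambda>_. A). F f) = (\<Sum>x\<in>A \<times> PiE (K - {m}) (\<lambda>_. A). F ((\<lambda>(a, g). g(m := a)) x))"
    by (rule sum.reindex_bij_betw[OF bij_betw_PiE_upd[OF assms], symmetric])
  also have "\<dots> = (\<Sum>a\<in>A. \<Sum>g\<in>PiE (K - {m}) (\<lambda>_. A). F (g(m := a)))"
    by (simp add: sum_times)
  also have "\<dots> = (\<Sum>g\<in>PiE (K - {m}) (\<lambda>_. A). \<Sum>a\<in>A. F (g(m := a)))"
    by (rule sum.swap)
  finally show ?thesis ..
qed

section \<open>Amplitudes and reduced state of the shared pure state\<close>

definition amp :: "nat \<Rightarrow> complex vec \<Rightarrow> nat \<Rightarrow> nat \<Rightarrow> complex" where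
  "amp d \<psi> a b = \<psi> $ (a * d + b)"

text \<open>The reduced state on the second factor, the half that stays with Bob.\<close>

definition marginal :: "nat \<Rightarrow> complex vec \<Rightarrow> nat \<Rightarrow> nat \<Rightarrow> complex" where
  "marginal d \<psi> x y = (\<Sum>c<d. amp d \<psi> c x * cnj (amp d \<psi> c y))"

definition entries2 :: "nat \<Rightarrow> complex mat \<Rightarrow> nat \<times> nat \<Rightarrow> nat \<times> nat \<Rightarrow> complex" where
  "entries2 d X = (\<lambda>(b, x) (b', x'). X $$ (b * d + x, b' * d + x'))"

lemma unit_vector_amp:
  assumes "unit_vector (d * d) \<psi>"
  shows "(\<Sum>a<d. \<Sum>b<d. (cmod (amp d \<psi> a b))\<^sup>2) = 1"
  using assms unfolding unit_vector_def sum_pair_index amp_def by simp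

lemma sum_marginal:
  assumes "unit_vector (d * d) \<psi>"
  shows "(\<Sum>x<d. marginal d \<psi> x x) = 1"
proof -
  have "(\<Sum>x<d. marginal d \<psi> x x) = (\<Sum>x<d. \<Sum>c<d. of_real ((cmod (amp d \<psi> c x))\<^sup>2))"
    unfolding marginal_def complex_norm_square ..
  also have "\<dots> = of_real (\<Sum>c<d. \<Sum>x<d. (cmod (amp d \<psi> c x))\<^sup>2)"
    unfolding of_real_sum by (rule sum.swap)
  finally show ?thesis using unit_vector_amp[OF assms] by simp
qed

section \<open>The position-based code\<close>

text \<open>\<open>h\<close> decodes an index of the \<open>D\<close>-dimensional system \<open>A\<^sup>K\<close> into the indices of its copies.\<close>

locale position_code =
  fixes dA K D :: nat and \<psi> :: "complex vec" and h :: "nat \<Rightarrow> nat \<Rightarrow> nat"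
  assumes psi: "unit_vector (dA * dA) \<psi>"
    and h: "bij_betw h {..<D} (PiE {..<K} (\<lambda>_. {..<dA}))"
begin

definition hinv :: "(nat \<Rightarrow> nat) \<Rightarrow> nat" where
  "hinv = the_inv_into {..<D} h"

lemma hinv: "f \<in> PiE {..<K} (\<lambda>_. {..<dA}) \<Longrightarrow> hinv f < D"
  "f \<in> PiE {..<K} (\<lambda>_. {..<dA}) \<Longrightarrow> h (hinv f) = f"
  using h bij_betwE[OF bij_betw_the_inv_into[OF h]] f_the_inv_into_f_bij_betw[OF h]
  by (auto simp: hinv_def)

lemma bij_hinv: "bij_betw hinv (PiE {..<K} (\<lambda>_. {..<dA})) {..<D}"
  unfolding hinv_def by (rule bij_betw_the_inv_into[OF h])

lemma h_in: "e < D \<Longrightarrow> h e \<in> PiE {..<K} (\<lambda>_. {..<dA})"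
  using h by (auto simp: bij_betw_def)

text \<open>The amplitudes of K copies of \<open>\<psi>\<close>, regrouped with all of Alice's
  halves (\<open>f\<close>) before all of Bob's halves (\<open>g\<close>).\<close>

definition shared :: "(nat \<Rightarrow> nat) \<Rightarrow> (nat \<Rightarrow> nat) \<Rightarrow> complex" where
  "shared f g = (\<Prod>k<K. amp dA \<psi> (f k) (g k))"

definition \<theta> :: "complex vec" where
  "\<theta> = vec (D * D) (\<lambda>r. shared (h (r div D)) (h (r mod D)))"

lemma \<theta>_index: "e < D \<Longrightarrow> f < D \<Longrightarrow> \<theta> $ (e * D + f) = shared (h e) (h f)"
  by (simp add: \<theta>_def pair_index_less)

lemma unit_\<theta>: "unit_vector (D * D) \<theta>"
proof -
  let ?P = "PiE {..<K} (\<lambda>_. {..<dA})"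
  have "(\<Sum>r<D * D. (cmod (\<theta> $ r))\<^sup>2) = (\<Sum>e<D. \<Sum>f<D. (cmod (shared (h e) (h f)))\<^sup>2)"
    unfolding sum_pair_index by (intro sum.cong refl) (simp add: \<theta>_index)
  also have "\<dots> = (\<Sum>e\<in>?P. \<Sum>f\<in>?P. (cmod (shared e f))\<^sup>2)"
    unfolding sum.reindex_bij_betw[OF h, symmetric, of "\<lambda>e. \<Sum>f\<in>?P. (cmod (shared e f))\<^sup>2"]
    by (rule sum.cong[OF refl]) (rule sum.reindex_bij_betw[OF h, of "\<lambda>f. (cmod (shared (h _) f))\<^sup>2"])
  also have "\<dots> = (\<Sum>e\<in>?P. \<Prod>k<K. \<Sum>a<dA. (cmod (amp dA \<psi> (e k) a))\<^sup>2)"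
    unfolding shared_def prod_norm[symmetric] prod_power_distrib
    by (rule sum.cong[OF refl], rule prod_sum_PiE[symmetric]) auto
  also have "\<dots> = (\<Prod>k<K. \<Sum>c<dA. \<Sum>a<dA. (cmod (amp dA \<psi> c a))\<^sup>2)"
    by (rule prod_sum_PiE[symmetric]) auto
  also have "\<dots> = 1" using unit_vector_amp[OF psi] by simp
  finally show ?thesis by (simp add: unit_vector_def \<theta>_def)
qed

text \<open>The basis index in M E_A of message \<open>m\<close> together with an E_A-state that has
  \<open>a\<close> in copy \<open>m\<close> and \<open>g\<close> in the others.\<close>

definition pos :: "nat \<Rightarrow> (nat \<Rightarrow> nat) \<Rightarrow> nat \<Rightarrow> nat" where
  "pos m g a = m * D + hinv (g(m := a))"

definition enc_index :: "(nat \<times> (nat \<Rightarrow> nat)) set" where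
  "enc_index = (SIGMA m:{..<K}. PiE ({..<K} - {m}) (\<lambda>_. {..<dA}))"

text \<open>The encoder reads the message \<open>m\<close> and discards all copies but the \<open>m\<close>-th, the Kraus index \<open>g\<close>
  being the basis state of the discarded copies.\<close>

definition Enc :: "complex mat \<Rightarrow> complex mat" where
  "Enc = kraus_map (K * D) dA enc_index (\<lambda>(m, g) a r. delta r (pos m g a))"

lemma upd_in:
  "m < K \<Longrightarrow> g \<in> PiE ({..<K} - {m}) (\<lambda>_. {..<dA}) \<Longrightarrow> a < dA \<Longrightarrow>
    g(m := a) \<in> PiE {..<K} (\<lambda>_. {..<dA})"
  by (auto simp: PiE_iff extensional_def)

lemma pos_less:
  "m < K \<Longrightarrow> g \<in> PiE ({..<K} - {m}) (\<lambda>_. {..<dA}) \<Longrightarrow> a < dA \<Longrightarrow> pos m g a < K * D"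
  unfolding pos_def by (intro pair_index_less hinv upd_in)

lemma finite_enc_index: "finite enc_index"
  unfolding enc_index_def by (intro finite_SigmaI finite_PiE) auto

lemma sum_enc_index: "(\<Sum>\<kappa>\<in>enc_index. F \<kappa>)
    = (\<Sum>m<K. \<Sum>g\<in>PiE ({..<K} - {m}) (\<lambda>_. {..<dA}). F (m, g))"
  for F :: "_ \<Rightarrow> complex"
  unfolding enc_index_def by (subst sum.Sigma) (auto intro!: finite_PiE)

text \<open>The triples \<open>(m, g, a)\<close> enumerate, through \<open>pos\<close>, every basis
  state of M E_A exactly once, so the completeness relation collapses to a sum over the input
  basis.\<close>

lemma Enc_channel: "is_channel (K * D) dA Enc"
  unfolding Enc_def
proof (rule is_channel_kraus_map[OF finite_enc_index])
  fix r r' assume r: "r < K * D" "r' < K * D"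
  let ?F = "\<lambda>p. delta r p * cnj (delta r' p)"
  have "(\<Sum>\<kappa>\<in>enc_index. \<Sum>a<dA. (case \<kappa> of (m, g) \<Rightarrow> \<lambda>a r. delta r (pos m g a)) a r
      * cnj ((case \<kappa> of (m, g) \<Rightarrow> \<lambda>a r. delta r (pos m g a)) a r'))
     = (\<Sum>m<K. \<Sum>g\<in>PiE ({..<K} - {m}) (\<lambda>_. {..<dA}). \<Sum>a<dA. ?F (m * D + hinv (g(m := a))))"
    unfolding sum_enc_index by (simp add: pos_def)
  also have "\<dots> = (\<Sum>m<K. \<Sum>f\<in>PiE {..<K} (\<lambda>_. {..<dA}). ?F (m * D + hinv f))"
    by (rule sum.cong[OF refl], rule sum_PiE_upd[where F = "\<lambda>f. ?F (_ * D + hinv f)"]) auto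
  also have "\<dots> = (\<Sum>m<K. \<Sum>e<D. ?F (m * D + e))"
    by (rule sum.cong[OF refl]) (rule sum.reindex_bij_betw[OF bij_hinv, of "\<lambda>e. ?F (_ * D + e)"])
  also have "\<dots> = (\<Sum>p<K * D. ?F p)" by (simp add: sum_pair_index)
  also have "\<dots> = delta r r'"
    using r by (subst sum_single[of _ r]) (auto simp: delta_def)
  finally show "(\<Sum>\<kappa>\<in>enc_index. \<Sum>a<dA. (case \<kappa> of (m, g) \<Rightarrow> \<lambda>a r. delta r (pos m g a)) a r
      * cnj ((case \<kappa> of (m, g) \<Rightarrow> \<lambda>a r. delta r (pos m g a)) a r')) = delta r r'" .
qed

lemma Enc_index:
  assumes "a < dA" "a' < dA"
  shows "Enc X $$ (a, a') = (\<Sum>m<K. \<Sum>g\<in>PiE ({..<K} - {m}) (\<lambda>_. {..<dA}). X $$ (pos m g a, pos m g a'))"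
proof -
  have "Enc X $$ (a, a') = (\<Sum>m<K. \<Sum>g\<in>PiE ({..<K} - {m}) (\<lambda>_. {..<dA}).
      \<Sum>r<K * D. \<Sum>r'<K * D. delta r (pos m g a) * X $$ (r, r') * cnj (delta r' (pos m g a')))"
    using assms unfolding Enc_def kraus_map_def by (simp add: sum_enc_index)
  also have "\<dots> = (\<Sum>m<K. \<Sum>g\<in>PiE ({..<K} - {m}) (\<lambda>_. {..<dA}). X $$ (pos m g a, pos m g a'))"
  proof (intro sum.cong refl)
    fix m g assume m: "m \<in> {..<K}" and g: "g \<in> PiE ({..<K} - {m}) (\<lambda>_. {..<dA})"
    have p: "pos m g a < K * D" "pos m g a' < K * D" using m g assms by (auto intro: pos_less)
    have "(\<Sum>r<K * D. \<Sum>r'<K * D. delta r (pos m g a) * X $$ (r, r') * cnj (delta r' (pos m g a')))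
       = (\<Sum>r'<K * D. X $$ (pos m g a, r') * cnj (delta r' (pos m g a')))"
      using p by (subst sum_single[of _ "pos m g a"]) (auto simp: delta_def)
    also have "\<dots> = X $$ (pos m g a, pos m g a')"
      using p by (subst sum_single[of _ "pos m g a'"]) (auto simp: delta_def)
    finally show "(\<Sum>r<K * D. \<Sum>r'<K * D. delta r (pos m g a) * X $$ (r, r') * cnj (delta r' (pos m g a')))
       = X $$ (pos m g a, pos m g a')" .
  qed
  finally show ?thesis .
qed

definition encoded :: "nat \<Rightarrow> complex mat" where
  "encoded m = tensor_id (K * D) dA D Enc (kron (ket_bra K m) (proj \<theta>))"

lemma input_index:
  assumes "m < K" "m' < K" "e < D" "e' < D" "f < D" "f' < D"
  shows "kron (ket_bra K m) (proj \<theta>) $$ ((m' * D + e) * D + f, (m' * D + e') * D + f')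
     = (if m' = m then shared (h e) (h f) * cnj (shared (h e') (h f')) else 0)"
proof -
  have dim: "dim_vec \<theta> = D * D" by (simp add: \<theta>_def)
  \<comment> \<open>Reassociation: the encoder groups the systems as (M E_A) E_B, while the input is
    the product of M with (E_A E_B).\<close>
  have e: "(m' * D + e) * D + f = m' * (D * D) + (e * D + f)"
     "(m' * D + e') * D + f' = m' * (D * D) + (e' * D + f')"
    by (simp_all add: algebra_simps)
  have lt: "e * D + f < D * D" "e' * D + f' < D * D" using assms by (auto intro: pair_index_less)
  have lt': "m' * (D * D) + (e * D + f) < K * (D * D)" "m' * (D * D) + (e' * D + f') < K * (D * D)"
    using assms lt by (auto intro: pair_index_less)
  have dm: "(m' * n + x) div n = m'" "(m' * n + x) mod n = x" if "x < n" for x n :: nat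
    using that by auto
  show ?thesis
    unfolding e kron_def using lt lt' assms
    by (simp add: ket_bra_def proj_def dim dm[OF lt(1)] dm[OF lt(2)] \<theta>_index)
qed

text \<open>Discarding Alice's halves other than copy \<open>m\<close> sums over \<open>g\<close>;
  the sum factorizes over the copies and leaves a reduced state of \<open>\<psi>\<close> in
  each.\<close>

lemma encoded_index:
  assumes m: "m < K" and a: "a < dA" "a' < dA" and f: "f < D" "f' < D"
  shows "encoded m $$ (a * D + f, a' * D + f') = amp dA \<psi> a (h f m) * cnj (amp dA \<psi> a' (h f' m))
     * (\<Prod>k\<in>{..<K} - {m}. marginal dA \<psi> (h f k) (h f' k))"
proof -
  let ?G = "\<lambda>m. PiE ({..<K} - {m}) (\<lambda>_. {..<dA})"
  have "encoded m $$ (a * D + f, a' * D + f')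
      = Enc (block (K * D) D f f' (kron (ket_bra K m) (proj \<theta>))) $$ (a, a')"
    using a f by (simp add: encoded_def tensor_id_def pair_index_less)
  also have "\<dots> = (\<Sum>m'<K. \<Sum>g\<in>?G m'. if m' = m then shared (g(m := a)) (h f) * cnj (shared (g(m := a')) (h f')) else 0)"
    unfolding Enc_index[OF a]
  proof (rule sum.cong[OF refl], rule sum.cong[OF refl])
    fix m' g assume "m' \<in> {..<K}" and g: "g \<in> ?G m'"
    then have m': "m' < K" by simp
    have u: "g(m' := a) \<in> PiE {..<K} (\<lambda>_. {..<dA})" "g(m' := a') \<in> PiE {..<K} (\<lambda>_. {..<dA})"
      by (rule upd_in[OF m' g a(1)]) (rule upd_in[OF m' g a(2)])
    have p: "pos m' g a < K * D" "pos m' g a' < K * D"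
      by (rule pos_less[OF m' g a(1)]) (rule pos_less[OF m' g a(2)])
    have "block (K * D) D f f' (kron (ket_bra K m) (proj \<theta>)) $$ (pos m' g a, pos m' g a')
       = kron (ket_bra K m) (proj \<theta>) $$ (pos m' g a * D + f, pos m' g a' * D + f')"
      using p by (simp add: block_def)
    also have "\<dots> = (if m' = m then shared (g(m := a)) (h f) * cnj (shared (g(m := a')) (h f')) else 0)"
      unfolding pos_def input_index[OF m m' hinv(1)[OF u(1)] hinv(1)[OF u(2)] f]
        hinv(2)[OF u(1)] hinv(2)[OF u(2)] by (rule if_cong) simp_all
    finally show "block (K * D) D f f' (kron (ket_bra K m) (proj \<theta>)) $$ (pos m' g a, pos m' g a') = \<dots>" .
  qed
  also have "\<dots> = (\<Sum>g\<in>?G m. shared (g(m := a)) (h f) * cnj (shared (g(m := a')) (h f')))"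
    using m by (subst sum_single[of _ m]) auto
  also have "\<dots> = (\<Sum>g\<in>?G m. amp dA \<psi> a (h f m) * cnj (amp dA \<psi> a' (h f' m))
       * (\<Prod>k\<in>{..<K} - {m}. amp dA \<psi> (g k) (h f k) * cnj (amp dA \<psi> (g k) (h f' k))))"
  proof (rule sum.cong[OF refl])
    fix g
    have s: "shared (g(m := a)) x = amp dA \<psi> a (x m) * (\<Prod>k\<in>{..<K} - {m}. amp dA \<psi> (g k) (x k))" for a x
      unfolding shared_def using m by (subst prod.remove[of _ m]) (auto intro!: prod.cong)
    show "shared (g(m := a)) (h f) * cnj (shared (g(m := a')) (h f'))
      = amp dA \<psi> a (h f m) * cnj (amp dA \<psi> a' (h f' m))
       * (\<Prod>k\<in>{..<K} - {m}. amp dA \<psi> (g k) (h f k) * cnj (amp dA \<psi> (g k) (h f' k)))"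
      unfolding s by (simp add: prod.distrib algebra_simps)
  qed
  also have "\<dots> = amp dA \<psi> a (h f m) * cnj (amp dA \<psi> a' (h f' m))
     * (\<Sum>g\<in>?G m. \<Prod>k\<in>{..<K} - {m}. amp dA \<psi> (g k) (h f k) * cnj (amp dA \<psi> (g k) (h f' k)))"
    by (simp add: sum_distrib_left)
  also have "(\<Sum>g\<in>?G m. \<Prod>k\<in>{..<K} - {m}. amp dA \<psi> (g k) (h f k) * cnj (amp dA \<psi> (g k) (h f' k)))
     = (\<Prod>k\<in>{..<K} - {m}. marginal dA \<psi> (h f k) (h f' k))"
    unfolding marginal_def by (intro prod_sum_PiE[symmetric]) auto
  finally show ?thesis .
qed

text \<open>For fixed indices of Bob's share, the block on which the channel acts is a scalar
  multiple of a block of the single-copy state. Homogeneity of \<open>N\<close> therefore suffices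
  to carry the one-copy output over to all K copies.\<close>

lemma received_index:
  assumes N: "is_channel dA dB N" and m: "m < K" and b: "b < dB" "b' < dB" and f: "f < D" "f' < D"
  shows "tensor_id dA dB D N (encoded m) $$ (b * D + f, b' * D + f')
    = coded_state {..<K} m (entries2 dA (tensor_id dA dB dA N (proj \<psi>))) (marginal dA \<psi>) (b, h f) (b', h f')"
proof -
  define c where "c = (\<Prod>k\<in>{..<K} - {m}. marginal dA \<psi> (h f k) (h f' k))"
  define P where "P = block dA dA (h f m) (h f' m) (proj \<psi>)"
  have hm: "h f m < dA" "h f' m < dA" using h_in[OF f(1)] h_in[OF f(2)] m by auto
  have dim: "dim_vec \<psi> = dA * dA" using psi by (auto simp: unit_vector_def)
  have "block dA D f f' (encoded m) = c \<cdot>\<^sub>m P"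
  proof (rule eq_matI)
    fix a a' assume "a < dim_row (c \<cdot>\<^sub>m P)" "a' < dim_col (c \<cdot>\<^sub>m P)"
    then have a: "a < dA" "a' < dA" by (simp_all add: P_def block_def)
    show "block dA D f f' (encoded m) $$ (a, a') = (c \<cdot>\<^sub>m P) $$ (a, a')"
      using a hm encoded_index[OF m a f]
      by (simp add: block_def P_def proj_def c_def dim pair_index_less amp_def)
  qed (simp_all add: P_def block_def)
  moreover have "P \<in> carrier_mat dA dA" by (simp add: P_def block_def)
  moreover have "N P \<in> carrier_mat dB dB" using N \<open>P \<in> _\<close> by (simp add: is_channel_def)
  ultimately have "N (block dA D f f' (encoded m)) $$ (b, b') = c * N P $$ (b, b')"
    using b channel_scale[OF N] by simp
  moreover have "tensor_id dA dB D N (encoded m) $$ (b * D + f, b' * D + f') = N (block dA D f f' (encoded m)) $$ (b, b')"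
    using b f by (simp add: tensor_id_def pair_index_less)
  moreover have "entries2 dA (tensor_id dA dB dA N (proj \<psi>)) (b, h f m) (b', h f' m) = N P $$ (b, b')"
    using b hm by (simp add: entries2_def tensor_id_def pair_index_less P_def)
  ultimately show ?thesis by (simp add: coded_state_def c_def)
qed

end

section \<open>The received state and its decoding\<close>

lemma psd_on_rank_one: "psd_on I (\<lambda>i j. w i * cnj (w j))"
proof -
  have "form_on I (\<lambda>i j. w i * cnj (w j)) v v = of_real ((cmod (\<Sum>i\<in>I. cnj (v i) * w i))\<^sup>2)" for v
    unfolding complex_norm_square cnj_sum form_on_def sum_product
    by (simp add: algebra_simps)
  then show ?thesis by (simp add: psd_on_def)
qed

text \<open>A Gram decomposition of \<open>B\<close> alone exhibits the product as a sum of
  conjugations of \<open>A\<close>.\<close>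

lemma psd_on_product:
  assumes A: "psd_on I A" and B: "psd_on J B" and fin: "finite I" "finite J"
  shows "psd_on (I \<times> J) (\<lambda>x y. A (fst x) (fst y) * B (snd x) (snd y))"
proof -
  obtain w where w: "\<And>i j. i \<in> J \<Longrightarrow> j \<in> J \<Longrightarrow> B i j = (\<Sum>k\<in>J. w k i * cnj (w k j))"
    using psd_on_gram[OF fin(2) B] by blast
  have "psd_on (I \<times> J) (\<lambda>x y. \<Sum>k\<in>J. \<Sum>i\<in>I. \<Sum>l\<in>I.
      (delta (fst x) i * w k (snd x)) * A i l * cnj (delta (fst y) l * w k (snd y)))"
    by (intro psd_on_sum psd_on_conjugate A)
  also have "?this \<longleftrightarrow> psd_on (I \<times> J) (\<lambda>x y. A (fst x) (fst y) * B (snd x) (snd y))"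
  proof (rule psd_on_cong)
    fix x y assume xy: "x \<in> I \<times> J" "y \<in> I \<times> J"
    have "(\<Sum>i\<in>I. \<Sum>l\<in>I. (delta (fst x) i * w k (snd x)) * A i l * cnj (delta (fst y) l * w k (snd y)))
       = A (fst x) (fst y) * (w k (snd x) * cnj (w k (snd y)))" for k
    proof -
      have "(\<Sum>i\<in>I. \<Sum>l\<in>I. (delta (fst x) i * w k (snd x)) * A i l * cnj (delta (fst y) l * w k (snd y)))
         = (\<Sum>l\<in>I. w k (snd x) * A (fst x) l * cnj (delta (fst y) l * w k (snd y)))"
        using xy fin by (subst sum_single[of _ "fst x"]) (auto simp: delta_def)
      also have "\<dots> = A (fst x) (fst y) * (w k (snd x) * cnj (w k (snd y)))"
        using xy fin by (subst sum_single[of _ "fst y"]) (auto simp: delta_def)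
      finally show ?thesis .
    qed
    then show "(\<Sum>k\<in>J. \<Sum>i\<in>I. \<Sum>l\<in>I.
        (delta (fst x) i * w k (snd x)) * A i l * cnj (delta (fst y) l * w k (snd y)))
       = A (fst x) (fst y) * B (snd x) (snd y)"
      using xy by (simp add: w mem_Times_iff sum_distrib_left)
  qed
  finally show ?thesis .
qed

lemma psd_on_partial_trace:
  assumes A: "psd_on (I \<times> J) A" and fin: "finite I" "finite J"
  shows "psd_on I (\<lambda>b b'. \<Sum>a\<in>J. A (b, a) (b', a))"
proof -
  have "psd_on I (\<lambda>b b'. \<Sum>a\<in>J. \<Sum>i\<in>I \<times> J. \<Sum>l\<in>I \<times> J. delta (b, a) i * A i l * cnj (delta (b', a) l))"
    by (intro psd_on_sum psd_on_conjugate A)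
  also have "?this \<longleftrightarrow> ?thesis"
  proof (intro psd_on_cong sum.cong[OF refl])
    fix b b' a assume m: "b \<in> I" "b' \<in> I" "a \<in> J"
    have "(\<Sum>i\<in>I \<times> J. \<Sum>l\<in>I \<times> J. delta (b, a) i * A i l * cnj (delta (b', a) l))
       = (\<Sum>l\<in>I \<times> J. A (b, a) l * cnj (delta (b', a) l))"
      using m fin by (subst sum_single[of _ "(b, a)"]) (auto simp: delta_def)
    also have "\<dots> = A (b, a) (b', a)"
      using m fin by (subst sum_single[of _ "(b', a)"]) (auto simp: delta_def)
    finally show "(\<Sum>i\<in>I \<times> J. \<Sum>l\<in>I \<times> J. delta (b, a) i * A i l * cnj (delta (b', a) l)) = A (b, a) (b', a)" .
  qed
  finally show ?thesis .
qed

lemma psd_on_marginal: "psd_on J (marginal d \<psi>)"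
  unfolding marginal_def by (intro psd_on_sum psd_on_rank_one)

lemma psd_proj:
  assumes v: "v \<in> carrier_vec n"
  shows "psd n (proj v)"
proof -
  have "psd_on {..<n} (\<lambda>i j. v $ i * cnj (v $ j))" by (rule psd_on_rank_one)
  also have "?this \<longleftrightarrow> psd_on {..<n} (\<lambda>i j. proj v $$ (i, j))"
    using v by (intro psd_on_cong) (simp add: proj_def)
  finally show ?thesis using v by (simp add: psd_iff_psd_on proj_def)
qed

lemma psd_message_proj:
  assumes v: "v \<in> carrier_vec n" and "m < K"
  shows "psd (K * n) (kron (ket_bra K m) (proj v))"
proof -
  define w where "w = vec (K * n) (\<lambda>r. if r div n = m then v $ (r mod n) else 0)"
  have "kron (ket_bra K m) (proj v) = proj w"
  proof (rule eq_matI)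
    fix i j assume "i < dim_row (proj w)" "j < dim_col (proj w)"
    then have ij: "i < K * n" "j < K * n" by (simp_all add: proj_def w_def)
    then have "0 < n" by (cases n) auto
    then have "i mod n < n" "j mod n < n" "i div n < K" "j div n < K"
      using ij by (auto simp: less_mult_imp_div_less)
    then show "kron (ket_bra K m) (proj v) $$ (i, j) = proj w $$ (i, j)"
      using v ij by (simp add: kron_def ket_bra_def proj_def w_def)
  qed (use v in \<open>simp_all add: kron_def ket_bra_def proj_def w_def\<close>)
  then show ?thesis by (simp add: psd_proj w_def)
qed

section \<open>Bipartite matrices as operators on index pairs\<close>

lemma entries2_reindex: "entries2 d X = (\<lambda>x y. X $$ ((\<lambda>(b, j). b * d + j) x, (\<lambda>(b, j). b * d + j) y))"
  by (auto simp: entries2_def fun_eq_iff)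

lemma psd_on_entries2:
  "psd (dB * d) X \<Longrightarrow> psd_on ({..<dB} \<times> {..<d}) (entries2 d X)"
  unfolding entries2_reindex psd_iff_psd_on psd_on_reindex[OF bij_betw_pair_index, of dB d] by blast

lemma psd_on_entries2_complement:
  assumes "psd (dB * d) (1\<^sub>m (dB * d) - X)" "X \<in> carrier_mat (dB * d) (dB * d)"
  shows "psd_on ({..<dB} \<times> {..<d}) (\<lambda>i j. delta i j - entries2 d X i j)"
proof -
  have "psd_on ({..<dB} \<times> {..<d}) (entries2 d (1\<^sub>m (dB * d) - X))"
    using assms(1) by (rule psd_on_entries2)
  also have "?this \<longleftrightarrow> ?thesis"
  proof (rule psd_on_cong)
    fix x y assume xy: "x \<in> {..<dB} \<times> {..<d}" "y \<in> {..<dB} \<times> {..<d}"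
    have "(\<lambda>(b, j). b * d + j) x = (\<lambda>(b, j). b * d + j) y \<longleftrightarrow> x = y"
      using bij_betw_pair_index[of d dB] xy unfolding bij_betw_def inj_on_def by blast
    moreover have "(\<lambda>(b, j). b * d + j) x < dB * d" "(\<lambda>(b, j). b * d + j) y < dB * d"
      using bij_betw_pair_index[of d dB] xy unfolding bij_betw_def by blast+
    ultimately show "entries2 d (1\<^sub>m (dB * d) - X) x y = delta x y - entries2 d X x y"
      using assms(2) by (simp add: entries2_reindex delta_def)
  qed
  finally show ?thesis .
qed

lemma tr_mult_eq_entries2:
  assumes "A \<in> carrier_mat (dB * d) (dB * d)" "X \<in> carrier_mat (dB * d) (dB * d)"
  shows "tr (A * X) = trace_on ({..<dB} \<times> {..<d}) (entries2 d A) (entries2 d X)"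
  unfolding tr_mult_eq_trace_on[OF assms] trace_on_reindex[OF bij_betw_pair_index, of dB d]
    entries2_reindex ..

text \<open>Trace preservation applies to each block, off-diagonal ones included, so the marginal
  does not depend on the channel. This is why one reference state serves all channels.\<close>

lemma ptrace1_channel_output:
  assumes N: "is_channel dA dB N" and psi: "unit_vector (dA * dA) \<psi>" and j: "j < dA" "j' < dA"
  shows "ptrace1 dB dA (tensor_id dA dB dA N (proj \<psi>)) $$ (j, j') = marginal dA \<psi> j j'"
proof -
  let ?P = "block dA dA j j' (proj \<psi>)"
  have dim: "dim_vec \<psi> = dA * dA" using psi by (auto simp: unit_vector_def)
  have P: "?P \<in> carrier_mat dA dA" by (simp add: block_def)
  then have NP: "N ?P \<in> carrier_mat dB dB" and trN: "tr (N ?P) = tr ?P" using N by (auto simp: is_channel_def)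
  have "ptrace1 dB dA (tensor_id dA dB dA N (proj \<psi>)) $$ (j, j') = tr (N ?P)"
    using j NP by (simp add: ptrace1_def tensor_id_def tr_def pair_index_less)
  also have "\<dots> = marginal dA \<psi> j j'"
    unfolding trN using j by (simp add: tr_def block_def proj_def dim marginal_def amp_def pair_index_less)
  finally show ?thesis .
qed

lemma channel_output_density:
  assumes N: "is_channel dA dB N" and psi: "unit_vector (dA * dA) \<psi>"
  defines "\<rho> \<equiv> entries2 dA (tensor_id dA dB dA N (proj \<psi>))"
  shows "psd_on ({..<dB} \<times> {..<dA}) \<rho>" "(\<Sum>b<dB. \<Sum>a<dA. \<rho> (b, a) (b, a)) = 1"
proof -
  have "psd (dA * dA) (proj \<psi>)" using psi by (intro psd_proj) (simp add: unit_vector_def)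
  then have "psd (dB * dA) (tensor_id dA dB dA N (proj \<psi>))" using N by (simp add: is_channel_def)
  then show "psd_on ({..<dB} \<times> {..<dA}) \<rho>" unfolding \<rho>_def by (rule psd_on_entries2)
  have "(\<Sum>b<dB. \<Sum>a<dA. \<rho> (b, a) (b, a)) = (\<Sum>a<dA. \<Sum>b<dB. \<rho> (b, a) (b, a))" by (rule sum.swap)
  also have "\<dots> = (\<Sum>a<dA. ptrace1 dB dA (tensor_id dA dB dA N (proj \<psi>)) $$ (a, a))"
    by (intro sum.cong refl) (simp add: ptrace1_def \<rho>_def entries2_def)
  also have "\<dots> = (\<Sum>a<dA. marginal dA \<psi> a a)"
    by (intro sum.cong refl) (simp add: ptrace1_channel_output[OF N psi])
  finally show "(\<Sum>b<dB. \<Sum>a<dA. \<rho> (b, a) (b, a)) = 1" using sum_marginal[OF psi] by simp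
qed

context position_code
begin

lemma psd_received:
  assumes N: "is_channel dA dB N" and m: "m < K"
  shows "psd (dB * D) (tensor_id dA dB D N (encoded m))"
proof -
  have "psd (K * D * D) (kron (ket_bra K m) (proj \<theta>))"
    using psd_message_proj[of \<theta> "D * D" m K] m unit_\<theta> by (simp add: unit_vector_def mult.assoc)
  then have "psd (dA * D) (encoded m)"
    using Enc_channel unfolding is_channel_def encoded_def by blast
  then show ?thesis using N unfolding is_channel_def by blast
qed

definition unindex :: "nat \<Rightarrow> nat \<times> (nat \<Rightarrow> nat)" where
  "unindex r = (r div D, h (r mod D))"

lemma bij_unindex: "bij_betw unindex {..<dB * D} ({..<dB} \<times> PiE {..<K} (\<lambda>_. {..<dA}))"
proof (rule bij_betw_byWitness[where f' = "\<lambda>(b, f). b * D + hinv f"])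
  have md: "r mod D < D" "r div D < dB" if "r < dB * D" for r
  proof -
    from that have "0 < D" by (cases D) auto
    then show "r mod D < D" by simp
    show "r div D < dB" using that by (simp add: less_mult_imp_div_less)
  qed
  have dm: "(b * D + hinv f) div D = b" "(b * D + hinv f) mod D = hinv f"
    if "f \<in> PiE {..<K} (\<lambda>_. {..<dA})" for b f
    using hinv(1)[OF that] by auto
  have hh: "hinv (h e) = e" if "e < D" for e
    using h that unfolding hinv_def bij_betw_def by (simp add: the_inv_into_f_f)
  show "\<forall>r\<in>{..<dB * D}. (\<lambda>(b, f). b * D + hinv f) (unindex r) = r"
    by (auto simp: unindex_def hh md)
  show "\<forall>x\<in>{..<dB} \<times> PiE {..<K} (\<lambda>_. {..<dA}). unindex ((\<lambda>(b, f). b * D + hinv f) x) = x"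
    using dm by (auto simp: unindex_def hinv)
  show "unindex ` {..<dB * D} \<subseteq> {..<dB} \<times> PiE {..<K} (\<lambda>_. {..<dA})"
    using md h_in by (simp add: unindex_def image_subset_iff)
  show "(\<lambda>(b, f). b * D + hinv f) ` ({..<dB} \<times> PiE {..<K} (\<lambda>_. {..<dA})) \<subseteq> {..<dB * D}"
    by (clarsimp simp: pair_index_less hinv(1))
qed

lemma received_unindex:
  assumes "is_channel dA dB N" "m < K" "r < dB * D" "r' < dB * D"
  shows "tensor_id dA dB D N (encoded m) $$ (r, r')
    = coded_state {..<K} m (entries2 dA (tensor_id dA dB dA N (proj \<psi>))) (marginal dA \<psi>) (unindex r) (unindex r')"
proof -
  from assms have "0 < D" by (cases D) auto
  then have "r mod D < D" "r' mod D < D" "r div D < dB" "r' div D < dB"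
    using assms by (auto simp: less_mult_imp_div_less)
  from received_index[OF assms(1,2) this(3,4,1,2)] show ?thesis
    by (simp add: unindex_def)
qed

text \<open>\<open>Dec\<close> is fixed before \<open>N\<close>: the measurement is built from
  \<open>L\<close> alone, and the channel enters only through the two traces in the bound. They are
  the missed detection at the right position and the false alarm at each of the K - 1 wrong
  ones.\<close>

theorem position_based_decoding:
  fixes dB :: nat and L :: "nat \<times> nat \<Rightarrow> nat \<times> nat \<Rightarrow> complex"
  assumes K: "0 < K" and c: "0 < c"
    and L: "psd_on ({..<dB} \<times> {..<dA}) L"
    and L1: "psd_on ({..<dB} \<times> {..<dA}) (\<lambda>i j. delta i j - L i j)"
  obtains Dec where "is_channel (dB * D) K Dec"
    "\<And>N m \<rho>. is_channel dA dB N \<Longrightarrow> m < K \<Longrightarrow>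
      \<rho> = entries2 dA (tensor_id dA dB dA N (proj \<psi>)) \<Longrightarrow>
      Re (\<Sum>m'\<in>{..<K} - {m}. Dec (tensor_id dA dB D N (encoded m)) $$ (m', m'))
      \<le> (1 + c) * Re (trace_on ({..<dB} \<times> {..<dA}) (\<lambda>i j. delta i j - L i j) \<rho>)
        + (2 + c + 1 / c) * (real (K - 1) * Re (trace_on ({..<dB} \<times> {..<dA}) L
            (\<lambda>i j. (\<Sum>a<dA. \<rho> (fst i, a) (fst j, a)) * marginal dA \<psi> (snd i) (snd j))))"
proof -
  define I where "I = {..<dB} \<times> PiE {..<K} (\<lambda>_. {..<dA})"
  define LL where "LL = (\<lambda>m. lift_on {..<K} m L)"
  have I: "finite I" unfolding I_def by (intro finite_cartesian_product finite_PiE) auto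
  have LL: "psd_on I (LL m)" "psd_on I (\<lambda>i j. delta i j - LL m i j)" if "m \<in> {..<K}" for m
    unfolding I_def LL_def
    by (rule psd_on_lift[OF L _ _ _ that], simp_all) (rule psd_on_lift_complement[OF L1 _ _ _ that], simp_all)
  obtain Om where Om: "\<And>m. m \<in> {..<K} \<Longrightarrow> psd_on I (Om m)"
    "psd_on I (\<lambda>i j. delta i j - (\<Sum>m\<in>{..<K}. Om m i j))"
    "\<And>m. m \<in> {..<K} \<Longrightarrow> psd_on I (\<lambda>i j. of_real (1 + c) * (delta i j - LL m i j)
        + of_real (2 + c + 1 / c) * (\<Sum>m'\<in>{..<K} - {m}. LL m' i j) - (delta i j - Om m i j))"
    by (rule hayashi_nagaoka[where L = LL and I = I and K = "{..<K}" and c = c, OF I finite_lessThan c LL]) blast+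
  define rest where "rest = (\<lambda>i j. delta i j - (\<Sum>m<K. Om m i j))"
  \<comment> \<open>the inconclusive outcome is assigned to message 0\<close>
  define Om' where "Om' = (\<lambda>m i j. Om m i j + (if m = 0 then rest i j else 0))"
  have rest: "psd_on I (\<lambda>i j. if m = 0 then rest i j else 0)" for m :: nat
    using Om(2) by (cases "m = 0") (simp_all add: rest_def, simp add: psd_on_def form_on_def)
  have Om': "psd_on I (Om' m)" if "m < K" for m
    unfolding Om'_def using that by (intro psd_on_add Om rest) simp
  have Om'_sum: "(\<Sum>m<K. Om' m i j) = delta i j" for i j
    using K by (simp add: Om'_def sum.distrib rest_def)
  note e = bij_unindex[of dB, folded I_def]
  have e_inj: "unindex i = unindex j \<longleftrightarrow> i = j" if "i < dB * D" "j < dB * D" for i j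
    using e that unfolding bij_betw_def inj_on_def by auto
  obtain Dec where Dec: "is_channel (dB * D) K Dec"
    "\<And>Y m. m < K \<Longrightarrow> Dec Y $$ (m, m)
       = trace_on {..<dB * D} (\<lambda>i j. Om' m (unindex i) (unindex j)) (\<lambda>i j. Y $$ (i, j))"
  proof (rule measurement_channel[of K "dB * D" "\<lambda>m i j. Om' m (unindex i) (unindex j)"])
    show "psd_on {..<dB * D} (\<lambda>i j. Om' m (unindex i) (unindex j))" if "m < K" for m
      using Om'[OF that] psd_on_reindex[OF e] by blast
    show "(\<Sum>m<K. Om' m (unindex i) (unindex j)) = delta i j" if "i < dB * D" "j < dB * D" for i j
      using that by (simp add: Om'_sum delta_def e_inj)
  qed blast
  have "Re (\<Sum>m'\<in>{..<K} - {m}. Dec (tensor_id dA dB D N (encoded m)) $$ (m', m'))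
      \<le> (1 + c) * Re (trace_on ({..<dB} \<times> {..<dA}) (\<lambda>i j. delta i j - L i j) \<rho>)
        + (2 + c + 1 / c) * (real (K - 1) * Re (trace_on ({..<dB} \<times> {..<dA}) L
            (\<lambda>i j. (\<Sum>a<dA. \<rho> (fst i, a) (fst j, a)) * marginal dA \<psi> (snd i) (snd j))))"
    if N: "is_channel dA dB N" and m: "m < K"
      and \<rho>: "\<rho> = entries2 dA (tensor_id dA dB dA N (proj \<psi>))" for N m \<rho>
  proof -
    define Y where "Y = coded_state {..<K} m \<rho> (marginal dA \<psi>)"
    define R where "R = tensor_id dA dB D N (encoded m)"
    have RY: "R $$ (i, j) = Y (unindex i) (unindex j)" if "i < dB * D" "j < dB * D" for i j
      unfolding R_def Y_def \<rho> by (rule received_unindex[OF N m that])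
    have "psd_on {..<dB * D} (\<lambda>i j. R $$ (i, j))"
      using psd_received[OF N m] unfolding R_def psd_iff_psd_on by blast
    also have "?this \<longleftrightarrow> psd_on {..<dB * D} (\<lambda>i j. Y (unindex i) (unindex j))"
      by (rule psd_on_cong) (simp add: RY)
    finally have Y: "psd_on I Y" using psd_on_reindex[OF e] by blast
    have out: "Dec R $$ (m', m') = trace_on I (Om' m') Y" if "m' < K" for m'
      unfolding Dec(2)[OF that] trace_on_reindex[OF e]
      by (rule trace_on_cong) (simp_all add: RY)
    let ?Bd = "\<lambda>i j. of_real (1 + c) * (delta i j - LL m i j)
        + of_real (2 + c + 1 / c) * (\<Sum>m'\<in>{..<K} - {m}. LL m' i j)"
    \<comment> \<open>The error operator for \<open>m\<close> is 1 - Om'_m. Since Om'_m exceeds Om_m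
      by a positive operator, the bound for Om_m carries over.\<close>
    have "psd_on I (\<lambda>i j. (?Bd i j - (delta i j - Om m i j)) + (if m = 0 then rest i j else 0))"
      by (rule psd_on_add[OF Om(3) rest]) (use m in simp)
    also have "(\<lambda>i j. (?Bd i j - (delta i j - Om m i j)) + (if m = 0 then rest i j else 0))
       = (\<lambda>i j. ?Bd i j - (\<Sum>m'\<in>{..<K} - {m}. Om' m' i j))"
    proof (intro ext)
      fix i j
      have eq: "(\<Sum>m'\<in>{..<K} - {m}. Om' m' i j) = delta i j - Om' m i j"
        using Om'_sum[of i j] m by (simp add: sum.remove[of _ m] eq_diff_eq add.commute)
      have alg: "(x - (d - y)) + z = x - (d - (y + z))" for x d y z :: complex by simp
      show "(?Bd i j - (delta i j - Om m i j)) + (if m = 0 then rest i j else 0)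
         = ?Bd i j - (\<Sum>m'\<in>{..<K} - {m}. Om' m' i j)"
        unfolding eq unfolding Om'_def by (rule alg)
    qed
    finally have "0 \<le> Re (trace_on I (\<lambda>i j. ?Bd i j - (\<Sum>m'\<in>{..<K} - {m}. Om' m' i j)) Y)"
      using trace_on_nonneg[OF I _ Y] by blast
    then have le: "Re (trace_on I (\<lambda>i j. \<Sum>m'\<in>{..<K} - {m}. Om' m' i j) Y) \<le> Re (trace_on I ?Bd Y)"
      by (simp only: trace_on_diff[where A = ?Bd] minus_complex.sel diff_ge_0_iff_ge)
    have \<tau>: "(\<Sum>a\<in>{..<dA}. marginal dA \<psi> a a) = 1" using sum_marginal[OF psi] by simp
    have 1: "trace_on I (\<lambda>i j. delta i j - LL m i j) Y
       = trace_on ({..<dB} \<times> {..<dA}) (\<lambda>i j. delta i j - L i j) \<rho>"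
    proof -
      have "trace_on I (\<lambda>i j. delta i j - LL m i j) Y
         = trace_on I (lift_on {..<K} m (\<lambda>i j. delta i j - L i j)) Y"
        unfolding LL_def I_def
        by (rule trace_on_cong, rule lift_on_complement[OF lessThan_iff[THEN iffD2, OF m]]) (assumption | rule refl)+
      also have "\<dots> = trace_on ({..<dB} \<times> {..<dA}) (\<lambda>i j. delta i j - L i j) \<rho>"
        unfolding I_def Y_def by (rule trace_on_lift_coded_state_same) (use m \<tau> in simp_all)
      finally show ?thesis .
    qed
    have 2: "trace_on I (LL m') Y = trace_on ({..<dB} \<times> {..<dA}) L
       (\<lambda>i j. (\<Sum>a<dA. \<rho> (fst i, a) (fst j, a)) * marginal dA \<psi> (snd i) (snd j))"
      if "m' \<in> {..<K} - {m}" for m'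
      unfolding LL_def I_def Y_def
      by (rule trace_on_lift_coded_state_other) (use m that \<tau> in simp_all)
    have "trace_on I ?Bd Y = of_real (1 + c) * trace_on I (\<lambda>i j. delta i j - LL m i j) Y
       + of_real (2 + c + 1 / c) * (\<Sum>m'\<in>{..<K} - {m}. trace_on I (LL m') Y)"
      unfolding trace_on_add trace_on_scale[where A = "\<lambda>i j. delta i j - LL m i j"]
        trace_on_scale[where A = "\<lambda>i j. \<Sum>m'\<in>{..<K} - {m}. LL m' i j"] trace_on_sum ..
    also have "\<dots> = of_real (1 + c) * trace_on ({..<dB} \<times> {..<dA}) (\<lambda>i j. delta i j - L i j) \<rho>
       + of_real (2 + c + 1 / c) * (of_real (real (K - 1)) * trace_on ({..<dB} \<times> {..<dA}) L
       (\<lambda>i j. (\<Sum>a<dA. \<rho> (fst i, a) (fst j, a)) * marginal dA \<psi> (snd i) (snd j)))"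
    proof -
      have "(\<Sum>m'\<in>{..<K} - {m}. trace_on I (LL m') Y)
         = (\<Sum>m'\<in>{..<K} - {m}. trace_on ({..<dB} \<times> {..<dA}) L
       (\<lambda>i j. (\<Sum>a<dA. \<rho> (fst i, a) (fst j, a)) * marginal dA \<psi> (snd i) (snd j)))"
        by (rule sum.cong[OF refl]) (rule 2)
      then show ?thesis using m by (simp add: 1)
    qed
    finally have Bd: "trace_on I ?Bd Y = \<dots>" .
    have "(\<Sum>m'\<in>{..<K} - {m}. Dec R $$ (m', m')) = trace_on I (\<lambda>i j. \<Sum>m'\<in>{..<K} - {m}. Om' m' i j) Y"
      unfolding trace_on_sum by (rule sum.cong[OF refl], rule out) simp
    with le have "Re (\<Sum>m'\<in>{..<K} - {m}. Dec R $$ (m', m')) \<le> Re (trace_on I ?Bd Y)"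
      by (simp only:)
    moreover have "Re (of_real x * z) = x * Re z" for x z by simp
    ultimately show ?thesis
      by (simp only: Bd R_def plus_complex.sel)
  qed
  with Dec(1) show thesis using that by blast
qed

end

section \<open>Compound channels\<close>

text \<open>A strict inequality below a supremum yields an actual test, and an infimum over states
  may be evaluated at any chosen one. If the type-two error is not positive, \<open>neglog2\<close>
  is infinite and the conclusion is immediate.\<close>

lemma I_H_test:
  assumes t: "ereal t < I_H eps dB dA \<rho>" and \<sigma>: "density dB \<sigma>"
  obtains M where "psd (dB * dA) M" "psd (dB * dA) (1\<^sub>m (dB * dA) - M)" "1 - eps \<le> Re (tr (M * \<rho>))"
    "Re (tr (M * kron \<sigma> (ptrace1 dB dA \<rho>))) < 2 powr (- t)"
proof -
  have "ereal t < D_H eps (dB * dA) \<rho> (kron \<sigma> (ptrace1 dB dA \<rho>))"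
    using t unfolding I_H_def by (rule less_INF_D) (use \<sigma> in simp)
  then obtain M where M: "psd (dB * dA) M" "psd (dB * dA) (1\<^sub>m (dB * dA) - M)" "1 - eps \<le> Re (tr (M * \<rho>))"
    and l: "ereal t < neglog2 (Re (tr (M * kron \<sigma> (ptrace1 dB dA \<rho>))))"
    unfolding D_H_def less_SUP_iff by auto
  define x where "x = Re (tr (M * kron \<sigma> (ptrace1 dB dA \<rho>)))"
  have "x < 2 powr (- t)"
  proof (cases "x \<le> 0")
    case True
    then show ?thesis by (rule le_less_trans) simp
  next
    case False
    then have "log 2 x < - t" using l unfolding x_def[symmetric] neglog2_def by simp
    then show ?thesis using False by (simp add: log_less_iff)
  qed
  with that M show thesis unfolding x_def by blast
qed

section \<open>Scalar estimates for the penalty term of the rate\<close>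

lemma two_powr_penalty:
  fixes eta eps L s :: real
  assumes "0 < eta" "0 < eps" "0 < L" "0 < s"
  shows "2 powr (2 * L * log 2 (eta / (6 * L)) + log 2 (eps / (4 * s)))
    = (eta / (6 * L)) powr (2 * L) * (eps / (4 * s))"
proof -
  have "2 powr (2 * L * log 2 (eta / (6 * L))) = (2 powr (log 2 (eta / (6 * L)))) powr (2 * L)"
    by (simp add: powr_powr mult.commute)
  then show ?thesis using assms by (simp add: powr_add)
qed

lemma error_coeff_le:
  fixes eta :: real
  assumes "0 < eta" "eta < 1"
  shows "2 + eta + 1 / eta \<le> 4 / eta"
proof -
  have "eta * eta \<le> 1" using assms by (simp add: mult_le_one)
  then have "eta \<le> 1 / eta" using assms by (simp add: field_simps)
  moreover have "2 \<le> 2 / eta" using assms by (simp add: field_simps)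
  moreover have "4 / eta = 2 / eta + 1 / eta + 1 / eta" by simp
  ultimately show ?thesis by linarith
qed

text \<open>The case of one channel, where log (2s) = 1 and \<open>eta / 6\<close> appears only
  squared. The inner factor 2 is the bit by which the rate is reduced when \<open>\<psi>\<close> is
  chosen.\<close>

lemma penalty_bound_single:
  fixes eta eps :: real
  assumes "0 < eta" "eta < 1" "0 < eps" "eps < 1"
  shows "(2 + eta + 1 / eta) * (2 * ((eta / 6) powr 2 * (eps / 4))) \<le> eta"
proof -
  have "(eta / 6) powr 2 = eta * eta / 36" using assms by (simp add: powr_numeral power2_eq_square)
  then have e: "2 * ((eta / 6) powr 2 * (eps / 4)) = eta * eta * eps / 72" by simp
  have "(2 + eta + 1 / eta) * (2 * ((eta / 6) powr 2 * (eps / 4))) \<le> (4 / eta) * (eta * eta * eps / 72)"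
    unfolding e using error_coeff_le[OF assms(1,2)] assms by (intro mult_right_mono) auto
  also have "\<dots> = eta * (eps / 18)" using assms by simp
  also have "\<dots> \<le> eta * 1" using assms by (intro mult_left_mono) auto
  finally show ?thesis by simp
qed

text \<open>As L >= 2, the power supplies both 2^(-2L) = 1 / (2s)^2, which cancels s^2, and eta^4,
  which outweighs the two divisions by eta coming from the merged test and from the Hayashi-Nagaoka
  coefficient.\<close>

lemma penalty_bound_union:
  fixes eta eps s :: real
  assumes eta: "0 < eta" "eta < 1" and eps: "0 < eps" "eps < 1" and s: "2 \<le> s"
    and L: "L = log 2 (2 * s)"
  shows "(2 + eta + 1 / eta) * (s\<^sup>2 * (2 * ((eta / (6 * L)) powr (2 * L) * (eps / (4 * s)))) / (eta / 2)) \<le> eta"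
proof -
  have "log 2 4 \<le> log 2 (2 * s)" using s by (intro log_mono) auto
  moreover have "log 2 4 = (2::real)" using log_of_power_eq[of 4 2 2] by simp
  ultimately have L2: "2 \<le> L" by (simp add: L)
  \<comment> \<open>Enlarging the base to \<open>eta / 2\<close> is affordable, and it makes the
    power of 2 exactly a power of \<open>2 * s\<close>.\<close>
  have "(eta / (6 * L)) powr (2 * L) \<le> (eta / 2) powr (2 * L)"
    using eta L2 by (intro powr_mono2 divide_left_mono) auto
  also have "\<dots> = eta powr (2 * L) / 2 powr (2 * L)" using eta by (simp add: powr_divide)
  also have "2 powr (2 * L) = (2 powr L) powr 2" by (simp add: powr_powr mult.commute)
  also have "2 powr L = 2 * s" using s by (simp add: L)
  also have "(2 * s) powr 2 = 4 * s\<^sup>2" using s by (simp add: powr_numeral power_mult_distrib)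
  also have "eta powr (2 * L) / (4 * s\<^sup>2) \<le> eta powr 4 / (4 * s\<^sup>2)"
    using eta L2 s by (intro divide_right_mono powr_mono') auto
  also have "eta powr 4 = eta ^ 4" using eta by (simp add: powr_numeral)
  finally have p: "(eta / (6 * L)) powr (2 * L) \<le> eta ^ 4 / (4 * s\<^sup>2)" .
  have "s\<^sup>2 * (2 * ((eta / (6 * L)) powr (2 * L) * (eps / (4 * s)))) / (eta / 2)
     \<le> s\<^sup>2 * (2 * (eta ^ 4 / (4 * s\<^sup>2) * (eps / (4 * s)))) / (eta / 2)"
    using p eta eps s by (intro divide_right_mono mult_left_mono mult_right_mono) auto
  also have "\<dots> = eta ^ 3 * (eps / (4 * s))"
    using eta s by (simp add: field_simps power2_eq_square power3_eq_cube power4_eq_xxxx)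
  also have "\<dots> \<le> eta ^ 3 * (1 / 4)"
    using eta eps s by (intro mult_left_mono) (auto simp: field_simps)
  finally have q: "s\<^sup>2 * (2 * ((eta / (6 * L)) powr (2 * L) * (eps / (4 * s)))) / (eta / 2) \<le> eta ^ 3 / 4"
    by simp
  have "(2 + eta + 1 / eta) * (s\<^sup>2 * (2 * ((eta / (6 * L)) powr (2 * L) * (eps / (4 * s)))) / (eta / 2))
     \<le> (4 / eta) * (eta ^ 3 / 4)"
    using error_coeff_le[OF eta] q eta eps s by (intro mult_mono) auto
  also have "\<dots> = eta * eta" using eta by (simp add: power3_eq_cube)
  also have "\<dots> \<le> eta * 1" using eta by (intro mult_left_mono) auto
  finally show ?thesis by simp
qed

lemma Re_trace_on_le:
  assumes "finite I" "psd_on I (\<lambda>i j. B i j - A i j)" "psd_on I Y"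
  shows "Re (trace_on I A Y) \<le> Re (trace_on I B Y)"
  using trace_on_nonneg[OF assms] by (simp add: trace_on_diff)

text \<open>\<open>d\<close> measures the loss in detection and \<open>1 / a\<close> the
  amplification of false alarms. A single test is used as it stands, with neither loss; merging
  would bring a factor 2/eta that the penalty for s = 1 cannot absorb.\<close>

lemma compound_test:
  fixes M :: "nat \<Rightarrow> 'i \<Rightarrow> 'i \<Rightarrow> complex" and eta :: real
  assumes I: "finite I" and s: "1 \<le> s" and eta: "0 < eta"
    and M: "\<And>i. i \<in> {1..s} \<Longrightarrow> psd_on I (M i)"
    and M1: "\<And>i. i \<in> {1..s} \<Longrightarrow> psd_on I (\<lambda>x y. delta x y - M i x y)"
  obtains L d a where "psd_on I L" "psd_on I (\<lambda>x y. delta x y - L x y)"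
    "(d, a) = (if s = 1 then (0, 1) else (eta / 2, eta / 2))"
    "\<And>i. i \<in> {1..s} \<Longrightarrow> psd_on I (\<lambda>x y. of_real (1 + d) * L x y - M i x y)"
    "psd_on I (\<lambda>x y. (\<Sum>i\<in>{1..s}. M i x y) - of_real a * L x y)"
proof (cases "s = 1")
  case True
  have z: "psd_on I (\<lambda>x y. 0)" by (simp add: psd_on_def form_on_def)
  show thesis
    by (rule that[of "M 1" 0 1]) (use True M M1 z in auto)
next
  case False
  let ?T = "\<lambda>x y. \<Sum>i\<in>{1..s}. M i x y"
  have T: "psd_on I ?T" by (rule psd_on_sum) (rule M)
  have TM: "psd_on I (\<lambda>x y. ?T x y - M i x y)" if "i \<in> {1..s}" for i
  proof -
    have "(\<lambda>x y. ?T x y - M i x y) = (\<lambda>x y. \<Sum>k\<in>{1..s} - {i}. M k x y)"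
      using that by (simp add: sum_diff1)
    moreover have "psd_on I (\<lambda>x y. \<Sum>k\<in>{1..s} - {i}. M k x y)"
      by (rule psd_on_sum) (use M in auto)
    ultimately show ?thesis by simp
  qed
  obtain L where L: "psd_on I L" "psd_on I (\<lambda>i j. delta i j - L i j)"
    "psd_on I (\<lambda>i j. ?T i j - of_real (eta / 2) * L i j)"
    "\<And>M. psd_on I M \<Longrightarrow> psd_on I (\<lambda>i j. delta i j - M i j) \<Longrightarrow> psd_on I (\<lambda>i j. ?T i j - M i j)
       \<Longrightarrow> psd_on I (\<lambda>i j. of_real (1 + eta / 2) * L i j - M i j)"
    by (rule resolvent_union[OF T half_gt_zero[OF eta] I]) blast
  show thesis
    by (rule that[OF L(1,2) _ L(4)[OF M M1 TM] L(3)]) (use False in auto)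
qed

theorem theorem1:
  fixes dA dB s :: nat and N :: "nat \<Rightarrow> complex mat \<Rightarrow> complex mat"
    and eps eta R :: real
  assumes "dA \<ge> 1" and "dB \<ge> 1" and "s \<ge> 1"
    and "\<forall>i \<in> {1..s}. is_channel dA dB (N i)"
    and "0 < eps" and "eps < 1" and "0 < eta" and "eta < 1"
    and "0 \<le> R"
    and "ereal R \<le> (SUP \<psi> \<in> {\<psi>. unit_vector (dA * dA) \<psi>}.
            (INF i \<in> {1..s}. I_H eps dB dA (tensor_id dA dB dA (N i) (proj \<psi>)))
            + ereal (2 * log 2 (2 * real s) * log 2 (eta / (6 * log 2 (2 * real s)))
                     + log 2 (eps / (4 * real s))))"
  shows "ea_code dA dB s N R (eps + 3 * eta)"
proof -
  define lg where "lg = log 2 (2 * real s)"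
  define pen where "pen = 2 * lg * log 2 (eta / (6 * lg)) + log 2 (eps / (4 * real s))"
  define J where "J = {..<dB} \<times> {..<dA}"
  have J: "finite J" by (simp add: J_def)
  have lg: "1 \<le> lg" unfolding lg_def using assms(3) by (simp add: le_log_iff)
  \<comment> \<open>Lowering the rate by one bit makes the inequality strict, so some state
    satisfies it; the bit returns as the factor 2 in \<open>K\<beta>\<close>.\<close>
  have "ereal (R - 1) < ereal R" by simp
  also note assms(10)
  finally obtain \<psi> where psi: "unit_vector (dA * dA) \<psi>"
    and inf: "ereal (R - 1) < (INF i \<in> {1..s}. I_H eps dB dA (tensor_id dA dB dA (N i) (proj \<psi>))) + ereal pen"
    unfolding less_SUP_iff pen_def lg_def by blast
  define t where "t = R - 1 - pen"
  \<comment> \<open>The infimum may be infinite, so the finite penalty is moved across by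
    cases.\<close>
  have t: "ereal t < (INF i \<in> {1..s}. I_H eps dB dA (tensor_id dA dB dA (N i) (proj \<psi>)))"
    using inf by (cases "INF i \<in> {1..s}. I_H eps dB dA (tensor_id dA dB dA (N i) (proj \<psi>))")
      (auto simp: t_def)
  define \<beta> where "\<beta> = 2 powr (- t)"
  have N: "is_channel dA dB (N i)" if "i \<in> {1..s}" for i using assms(4) that by blast
  define out where "out = (\<lambda>i. tensor_id dA dB dA (N i) (proj \<psi>))"
  define \<rho> where "\<rho> = (\<lambda>i. entries2 dA (out i))"
  define \<rho>B where "\<rho>B = (\<lambda>i b b'. \<Sum>a<dA. \<rho> i (b, a) (b', a))"
  define X where "X = (\<lambda>i x y. \<rho>B i (fst x) (fst y) * marginal dA \<psi> (snd x) (snd y))"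
  have \<rho>: "psd_on J (\<rho> i)" "(\<Sum>b<dB. \<rho>B i b b) = 1" if "i \<in> {1..s}" for i
    using channel_output_density[OF N[OF that] psi] unfolding J_def \<rho>_def \<rho>B_def out_def by auto
  have \<rho>B: "psd_on {..<dB} (\<rho>B i)" if "i \<in> {1..s}" for i
    using psd_on_partial_trace[OF \<rho>(1)[OF that, unfolded J_def]] unfolding \<rho>B_def by simp
  have X: "psd_on J (X i)" if "i \<in> {1..s}" for i
    unfolding X_def J_def by (intro psd_on_product \<rho>B psd_on_marginal that) auto
  define \<sigma> where "\<sigma> = mat dB dB (\<lambda>(b, b'). of_real (1 / real s) * (\<Sum>i\<in>{1..s}. \<rho>B i b b'))"
  have \<sigma>: "density dB \<sigma>"
  proof -
    have "psd_on {..<dB} (\<lambda>b b'. of_real (1 / real s) * (\<Sum>i\<in>{1..s}. \<rho>B i b b'))"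
      by (intro psd_on_scale psd_on_sum \<rho>B) auto
    also have "?this \<longleftrightarrow> psd_on {..<dB} (\<lambda>b b'. \<sigma> $$ (b, b'))"
      by (rule psd_on_cong) (simp add: \<sigma>_def)
    finally have "psd dB \<sigma>" by (simp add: psd_iff_psd_on \<sigma>_def)
    have "tr \<sigma> = (\<Sum>b<dB. of_real (1 / real s) * (\<Sum>i\<in>{1..s}. \<rho>B i b b))"
      by (simp add: tr_def \<sigma>_def)
    also have "\<dots> = of_real (1 / real s) * (\<Sum>b<dB. \<Sum>i\<in>{1..s}. \<rho>B i b b)"
      by (rule sum_distrib_left[symmetric])
    also have "(\<Sum>b<dB. \<Sum>i\<in>{1..s}. \<rho>B i b b) = (\<Sum>i\<in>{1..s}. \<Sum>b<dB. \<rho>B i b b)" by (rule sum.swap)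
    also have "\<dots> = of_nat s" by (simp add: \<rho>)
    finally have "tr \<sigma> = 1" using assms(3) by simp
    with \<open>psd dB \<sigma>\<close> show ?thesis by (simp add: density_def)
  qed
  have "\<exists>M. psd (dB * dA) M \<and> psd (dB * dA) (1\<^sub>m (dB * dA) - M) \<and> 1 - eps \<le> Re (tr (M * out i))
      \<and> Re (tr (M * kron \<sigma> (ptrace1 dB dA (out i)))) < \<beta>" if "i \<in> {1..s}" for i
  proof -
    have "ereal t < I_H eps dB dA (out i)" using t that unfolding out_def by (rule less_INF_D)
    from I_H_test[OF this \<sigma>] show ?thesis unfolding \<beta>_def by metis
  qed
  then obtain M where M: "\<And>i. i \<in> {1..s} \<Longrightarrow> psd (dB * dA) (M i)"
    "\<And>i. i \<in> {1..s} \<Longrightarrow> psd (dB * dA) (1\<^sub>m (dB * dA) - M i)"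
    "\<And>i. i \<in> {1..s} \<Longrightarrow> 1 - eps \<le> Re (tr (M i * out i))"
    "\<And>i. i \<in> {1..s} \<Longrightarrow> Re (tr (M i * kron \<sigma> (ptrace1 dB dA (out i)))) < \<beta>"
    by metis
  have carr: "M i \<in> carrier_mat (dB * dA) (dB * dA)" "out i \<in> carrier_mat (dB * dA) (dB * dA)"
    if "i \<in> {1..s}" for i
    using M(1)[OF that] by (simp_all add: psd_def out_def tensor_id_def)
  define E where "E = (\<lambda>i. entries2 dA (M i))"
  have E: "psd_on J (E i)" "psd_on J (\<lambda>x y. delta x y - E i x y)" "1 - eps \<le> Re (trace_on J (E i) (\<rho> i))"
    if "i \<in> {1..s}" for i
    unfolding J_def E_def \<rho>_def
    using psd_on_entries2[OF M(1)[OF that]] psd_on_entries2_complement[OF M(2)[OF that] carr(1)[OF that]]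
      M(3)[OF that] tr_mult_eq_entries2[OF carr[OF that]] by simp_all
  have EX_avg: "(\<Sum>j\<in>{1..s}. Re (trace_on J (E i) (X j))) < real s * \<beta>" if i: "i \<in> {1..s}" for i
  proof -
    let ?S = "kron \<sigma> (ptrace1 dB dA (out i))"
    have S: "?S \<in> carrier_mat (dB * dA) (dB * dA)" by (simp add: kron_def \<sigma>_def ptrace1_def)
    have "tr (M i * ?S) = trace_on J (E i) (entries2 dA ?S)"
      unfolding J_def E_def by (rule tr_mult_eq_entries2[OF carr(1)[OF i] S])
    also have "\<dots> = trace_on J (E i) (\<lambda>x y. of_real (1 / real s) * (\<Sum>j\<in>{1..s}. X j x y))"
    proof (rule trace_on_cong[OF refl])
      fix x y assume "x \<in> J" "y \<in> J"
      then obtain b a b' a' where e: "x = (b, a)" "y = (b', a')" "b < dB" "b' < dB" "a < dA" "a' < dA"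
        by (auto simp: J_def)
      have "ptrace1 dB dA (out i) $$ (a, a') = marginal dA \<psi> a a'"
        unfolding out_def by (rule ptrace1_channel_output[OF N[OF i] psi e(5,6)])
      moreover have "dim_row (ptrace1 dB dA (out i)) = dA" "dim_col (ptrace1 dB dA (out i)) = dA"
        by (simp_all add: ptrace1_def)
      ultimately have "entries2 dA ?S x y = \<sigma> $$ (b, b') * marginal dA \<psi> a a'"
        using e by (simp add: entries2_def kron_def \<sigma>_def pair_index_less)
      also have "\<sigma> $$ (b, b') = of_real (1 / real s) * (\<Sum>j\<in>{1..s}. \<rho>B j b b')"
        using e by (simp add: \<sigma>_def)
      finally show "entries2 dA ?S x y = of_real (1 / real s) * (\<Sum>j\<in>{1..s}. X j x y)"
        by (simp add: X_def e sum_distrib_right)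
    qed
    also have "\<dots> = of_real (1 / real s) * (\<Sum>j\<in>{1..s}. trace_on J (E i) (X j))"
    proof -
      have c: "trace_on J (E i) Y = trace_on J (\<lambda>x y. Y x y) (\<lambda>x y. E i x y)" for Y
        unfolding trace_on_def by (subst sum.swap) (simp add: mult.commute)
      show ?thesis unfolding c trace_on_scale[where A = "\<lambda>x y. \<Sum>j\<in>{1..s}. X j x y"] trace_on_sum ..
    qed
    finally have "Re (tr (M i * ?S)) = (\<Sum>j\<in>{1..s}. Re (trace_on J (E i) (X j))) / real s"
      by simp
    with M(4)[OF i] assms(3) show ?thesis by (simp add: field_simps)
  qed
  \<comment> \<open>All summands of the average are nonnegative, so each is at most the sum: the
    first factor s.\<close>
  have EX: "Re (trace_on J (E i) (X j)) \<le> real s * \<beta>" if i: "i \<in> {1..s}" and j: "j \<in> {1..s}" for i j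
  proof -
    have "Re (trace_on J (E i) (X j)) \<le> (\<Sum>j\<in>{1..s}. Re (trace_on J (E i) (X j)))"
      using j trace_on_nonneg[OF J E(1)[OF i] X] by (intro member_le_sum) auto
    with EX_avg[OF i] show ?thesis by simp
  qed
  obtain L d a where L: "psd_on J L" "psd_on J (\<lambda>x y. delta x y - L x y)"
    and da: "(d, a) = (if s = 1 then (0, 1) else (eta / 2, eta / 2))"
    and LE: "\<And>i. i \<in> {1..s} \<Longrightarrow> psd_on J (\<lambda>x y. of_real (1 + d) * L x y - E i x y)"
    and LT: "psd_on J (\<lambda>x y. (\<Sum>i\<in>{1..s}. E i x y) - of_real a * L x y)"
    by (rule compound_test[OF J assms(3) assms(7) E(1,2)]) auto
  have d: "0 \<le> d" "0 < a" using da assms(7) by (auto split: if_splits)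
  \<comment> \<open>From (1 + d) q >= 1 - eps and q <= 1 one gets 1 - q <= eps + d q <= eps +
    d.\<close>
  have miss: "Re (trace_on J (\<lambda>x y. delta x y - L x y) (\<rho> i)) \<le> eps + d" if i: "i \<in> {1..s}" for i
  proof -
    define q where "q = Re (trace_on J L (\<rho> i))"
    have "Re (of_real (1 + d) * z) = (1 + d) * Re z" for z by simp
    then have 1: "1 - eps \<le> (1 + d) * q"
      using Re_trace_on_le[OF J LE[OF i] \<rho>(1)[OF i]] E(3)[OF i]
      unfolding trace_on_scale q_def by (metis order_trans)
    have "trace_on J delta (\<rho> i) = 1"
      using \<rho>(2)[OF i] unfolding trace_on_delta[OF J] \<rho>B_def unfolding J_def sum_times .
    then have 2: "Re (trace_on J (\<lambda>x y. delta x y - L x y) (\<rho> i)) = 1 - q"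
      by (simp add: trace_on_diff q_def)
    then have "q \<le> 1"
      using trace_on_nonneg[OF J L(2) \<rho>(1)[OF i]] by simp
    then have "d * q \<le> d * 1" using d by (intro mult_left_mono)
    then show ?thesis using 1 unfolding 2 by (simp add: algebra_simps)
  qed
  have false_alarm: "Re (trace_on J L (X j)) \<le> (real s)\<^sup>2 * \<beta> / a" if j: "j \<in> {1..s}" for j
  proof -
    have "a * Re (trace_on J L (X j)) \<le> (\<Sum>i\<in>{1..s}. Re (trace_on J (E i) (X j)))"
      using Re_trace_on_le[OF J LT X[OF j]] unfolding trace_on_scale trace_on_sum by simp
    \<comment> \<open>The second factor s: the merged test inherits the false alarms of all s
      tests.\<close>
    also have "\<dots> \<le> (\<Sum>i\<in>{1..s}. real s * \<beta>)" by (intro sum_mono EX j)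
    also have "\<dots> = (real s)\<^sup>2 * \<beta>" by (simp add: power2_eq_square)
    finally show ?thesis using d by (simp add: field_simps)
  qed
  define K where "K = num_msgs R"
  \<comment> \<open>Nonnegative rate means at least one message, so message 0 is there to receive
    the inconclusive outcome.\<close>
  have "1 \<le> 2 powr R" using assms(9) by (simp add: ge_one_powr_ge_zero)
  then have K: "0 < K" "real K \<le> 2 powr R"
    unfolding K_def num_msgs_def by (auto simp: le_nat_floor)
  have K\<beta>: "real (K - 1) * \<beta> \<le> 2 * ((eta / (6 * lg)) powr (2 * lg) * (eps / (4 * real s)))"
  proof -
    have "real (K - 1) * \<beta> \<le> 2 powr R * \<beta>"
      using K by (intro mult_right_mono) (auto simp: \<beta>_def)
    also have "\<dots> = 2 powr (R - t)" by (simp add: \<beta>_def powr_diff powr_minus_divide)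
    also have "\<dots> = 2 * 2 powr pen" by (simp add: t_def powr_add)
    also have "2 powr pen = (eta / (6 * lg)) powr (2 * lg) * (eps / (4 * real s))"
      unfolding pen_def using assms lg by (intro two_powr_penalty) auto
    finally show ?thesis .
  qed
  \<comment> \<open>One eta pays for the false alarms. The other two cover d <= eta/2, eta * eps <=
    eta and eta * d <= eta/2.\<close>
  have total: "(1 + eta) * (eps + d) + (2 + eta + 1 / eta) * (real (K - 1) * ((real s)\<^sup>2 * \<beta> / a)) \<le> eps + 3 * eta"
  proof -
    have "(2 + eta + 1 / eta) * (real (K - 1) * ((real s)\<^sup>2 * \<beta> / a))
       = (2 + eta + 1 / eta) * ((real s)\<^sup>2 * (real (K - 1) * \<beta>) / a)" by simp
    also have "\<dots> \<le> (2 + eta + 1 / eta) * ((real s)\<^sup>2 * (2 * ((eta / (6 * lg)) powr (2 * lg) * (eps / (4 * real s)))) / a)"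
      using K\<beta> assms(7) d by (intro mult_left_mono divide_right_mono) auto
    also have "\<dots> \<le> eta"
    proof (cases "s = 1")
      case True
      then show ?thesis
        using penalty_bound_single[OF assms(7,8,5,6)] da by (simp add: lg_def)
    next
      case False
      then have "a = eta / 2" "2 \<le> real s" using da assms(3) by auto
      then show ?thesis
        using penalty_bound_union[OF assms(7,8,5,6) _ lg_def] by blast
    qed
    finally have "(2 + eta + 1 / eta) * (real (K - 1) * ((real s)\<^sup>2 * \<beta> / a)) \<le> eta" .
    moreover have "(1 + eta) * (eps + d) \<le> eps + 2 * eta"
    proof -
      have "d \<le> eta / 2" using da assms(7) by (auto split: if_splits)
      moreover have "eta * eps \<le> eta * 1" using assms by (intro mult_left_mono) auto
      moreover have "eta * d \<le> 1 * (eta / 2)" using d assms \<open>d \<le> eta / 2\<close> by (intro mult_mono) auto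
      ultimately show ?thesis by (simp add: algebra_simps)
    qed
    ultimately show ?thesis by simp
  qed
  define P where "P = PiE {..<K} (\<lambda>_. {..<dA})"
  \<comment> \<open>Each party's share consists of K halves, so its basis is enumerated by the
    functions in \<open>P\<close>.\<close>
  define D where "D = card P"
  have "finite P" unfolding P_def by (intro finite_PiE) auto
  then obtain h where h: "bij_betw h {..<D} P"
    using ex_bij_betw_nat_finite[of P] unfolding D_def atLeast0LessThan by blast
  interpret position_code dA K D \<psi> h
    by unfold_locales (use psi h in \<open>auto simp: P_def\<close>)
  obtain Dec where Dec: "is_channel (dB * D) K Dec"
    and err: "\<And>N m \<rho>. is_channel dA dB N \<Longrightarrow> m < K \<Longrightarrow>
      \<rho> = entries2 dA (tensor_id dA dB dA N (proj \<psi>)) \<Longrightarrow>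
      Re (\<Sum>m'\<in>{..<K} - {m}. Dec (tensor_id dA dB D N (encoded m)) $$ (m', m'))
      \<le> (1 + eta) * Re (trace_on J (\<lambda>i j. delta i j - L i j) \<rho>)
        + (2 + eta + 1 / eta) * (real (K - 1) * Re (trace_on J L
            (\<lambda>i j. (\<Sum>a<dA. \<rho> (fst i, a) (fst j, a)) * marginal dA \<psi> (snd i) (snd j))))"
    by (rule position_based_decoding[OF K(1) assms(7) L[unfolded J_def], folded J_def]) blast
  have bound: "Re (\<Sum>m'\<in>{..<K} - {m}. Dec (tensor_id dA dB D (N i) (encoded m)) $$ (m', m')) \<le> eps + 3 * eta"
    if m: "m < K" and i: "i \<in> {1..s}" for m i
  proof -
    have "Re (\<Sum>m'\<in>{..<K} - {m}. Dec (tensor_id dA dB D (N i) (encoded m)) $$ (m', m'))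
      \<le> (1 + eta) * Re (trace_on J (\<lambda>i j. delta i j - L i j) (\<rho> i))
        + (2 + eta + 1 / eta) * (real (K - 1) * Re (trace_on J L (X i)))"
      using err[OF N[OF i] m, of "\<rho> i"] unfolding X_def \<rho>B_def \<rho>_def out_def by blast
    also have "\<dots> \<le> (1 + eta) * (eps + d) + (2 + eta + 1 / eta) * (real (K - 1) * ((real s)\<^sup>2 * \<beta> / a))"
      using miss[OF i] false_alarm[OF i] assms(7) by (intro add_mono mult_left_mono) auto
    finally show ?thesis using total by linarith
  qed
  show ?thesis
    unfolding ea_code_def Let_def K_def[symmetric]
    by (rule exI[of _ D], rule exI[of _ D], rule exI[of _ \<theta>], rule exI[of _ Enc], rule exI[of _ Dec])
      (use unit_\<theta> Enc_channel Dec bound in \<open>auto simp: encoded_def\<close>)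
qed



end
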